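(* For any $\alpha>0$ and $\gamma\in(0,2)$, there exist constants $\tau_\alpha,C_0,C_2>0$ (depending only on $\alpha$ and $\gamma$) such that the following holds for all $\tau\ge\tau_\alpha$, all $d\ge1$, all $\eta\in\mathbb{R}^d$ with $|\eta_1|\ge\cdots\ge|\eta_d|>0$, and all $\sigma>0$. If an estimator $\hat T$ satisfies $$\sup_{\theta\in\Theta_s}\ \sup_{\mathcal P_\xi\in\mathcal G_{\alpha,\tau}^{\otimes}}\mathbb{E}_{\theta,\mathcal P_\xi}\big(\hat T-L(\theta)\big)^2\ \le\ \frac{\sigma^2}{C_0}\,\Phi_{\rm adp}(s;\eta)\quad\text{for some integer } s\in[d],$$ then, for this $s$, $$\sup_{\theta\in\Theta_1}\ \sup_{\mathcal P_\xi\in\mathcal G_{\alpha,\tau}^{\otimes}}\mathbb{E}_{\theta,\mathcal P_\xi}\big(\hat T-L(\theta)\big)^2\ \ge\ \sigma^2C_2\max\left\{\frac{\Phi_{\rm adp}(s;\eta)}{(\min(s,s_0))^{\gamma}},\ \Phi_{\rm o}(1;\eta)\right\}.$$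
   Context: Model: $[d]=\{1,\dots,d\}$; $\eta\in\mathbb{R}^d$ is known with $|\eta_1|\ge\cdots\ge|\eta_d|>0$; one observes $y_j=\theta_j+\sigma\xi_j$, $j\in[d]$, with $\theta\in\mathbb{R}^d$ unknown, $\sigma>0$ known, and $\xi_1,\dots,\xi_d$ independent with joint law $\mathcal P_\xi$; $\mathbb{E}_{\theta,\mathcal P_\xi}$ is the corresponding expectation. $L(\theta)=\sum_{j=1}^d\eta_j\theta_j$, $\Theta_s=\{\theta\in\mathbb{R}^d:\#\{j:\theta_j\ne0\}\le s\}$. An estimator is a measurable real-valued function of $(y_1,\dots,y_d)$. Noise class: $\mathcal G_{\alpha,\tau}$ is the class of laws on $\mathbb{R}$ of random variables $W$ symmetric around $0$ with $\mathbb{E}(W^2)=1$ and $\mathbb{P}(|W|\ge t)\le2\exp\{-2(t/\tau)^\alpha\}$ for all $t\ge0$; $\mathcal G_{\alpha,\tau}^{\otimes}=\{\otimes_{j=1}^dP_j:P_j\in\mathcal G_{\alpha,\tau}\}$. Rates: for $\beta\in\mathbb{R}$ let $\phi(\beta)=\sum_{j=1}^d|\eta_j|e^{-\beta/|\eta_j|^\alpha}\big/\sqrt{\sum_{j=1}^d\eta_j^2e^{-\beta/|\eta_j|^\alpha}}$, a continuous strictly decreasing function from $+\infty$ to $0$. Oracle rate: for real $s\in[1,d]$ let $\beta$ solve $\phi(\beta)=s/2$, $\lambda_o=(\max(\beta,0))^{1/\alpha}$, $\nu=\sqrt{\sum_j\eta_j^2\exp(-(\lambda_o/|\eta_j|)^\alpha)}$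 and $\Phi_{\rm o}(s;\eta)=(\lambda_os+\nu)^2$. Adaptive rate: for real $s\in[1,d]$ let $\beta_*(s)$ solve $\phi(\beta_* )=s/(2\sqrt{\log(es)})$, $\lambda_*(s)=(\max(\beta_*(s),0))^{1/\alpha}$, $\nu_*(s)=\sqrt{\log(es)\sum_{j}\eta_j^2\exp(-(\lambda_*(s)/|\eta_j|)^\alpha)}$. Let $s_*=\max\{s\in[d]:\lambda_*(s)>0\}$ ($0$ if empty), $s_0=s_*+1$; $\Phi_*(s;\eta)=s^2\lambda_*^2(s)+\nu_*^2(s)$ if $s\le s_0$ and $\Phi_*(s;\eta)=\Phi_*(s_0;\eta)$ otherwise. Finally $\Phi_{\rm adp}(s;\eta)=\max\{\Phi_*(s;\eta),\Phi_*(1;\eta)\log^2(e\min(s,s_0))\}$ if $0<\alpha<2$, and $\Phi_{\rm adp}(s;\eta)=\Phi_*(s;\eta)$ if $\alpha\ge2$. *)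

theory Defs
  imports "HOL-Probability.Probability"
begin

text \<open>
  Vectors in \<open>\<real>\<^sup>d\<close> are functions \<^typ>\<open>nat \<Rightarrow> real\<close>, used only at the indices \<open>1, \<dots>, d\<close>;
  as a measurable space, \<open>\<real>\<^sup>d\<close> is \<open>PiM {1..d} (\<lambda>_. borel)\<close>.
\<close>

section \<open>The statistical model\<close>

definition lin_fun :: "nat \<Rightarrow> (nat \<Rightarrow> real) \<Rightarrow> (nat \<Rightarrow> real) \<Rightarrow> real" where
  "lin_fun d \<eta> \<theta> = (\<Sum>j=1..d. \<eta> j * \<theta> j)"

definition sparse_class :: "nat \<Rightarrow> nat \<Rightarrow> (nat \<Rightarrow> real) set" where
  "sparse_class d s = {\<theta> \<in> {1..d} \<rightarrow>\<^sub>E UNIV. card {j \<in> {1..d}. \<theta> j \<noteq> 0} \<le> s}"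

definition noise_class :: "real \<Rightarrow> real \<Rightarrow> real measure set" where
  "noise_class \<alpha> \<tau> =
     {P. prob_space P \<and> sets P = sets borel \<and>
         distr P borel uminus = P \<and>
         has_bochner_integral P (\<lambda>x. x\<^sup>2) 1 \<and>
         (\<forall>t\<ge>0. measure P {x. \<bar>x\<bar> \<ge> t} \<le> 2 * exp (- 2 * (t / \<tau>) powr \<alpha>))}"

definition noise_prod_class :: "nat \<Rightarrow> real \<Rightarrow> real \<Rightarrow> (nat \<Rightarrow> real) measure set" where
  "noise_prod_class d \<alpha> \<tau> = {PiM {1..d} P | P. \<forall>j\<in>{1..d}. P j \<in> noise_class \<alpha> \<tau>}"

definition obs_law ::
    "nat \<Rightarrow> real \<Rightarrow> (nat \<Rightarrow> real) \<Rightarrow> (nat \<Rightarrow> real) measure \<Rightarrow> (nat \<Rightarrow> real) measure" where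
  "obs_law d \<sigma> \<theta> Q =
     distr Q (PiM {1..d} (\<lambda>_. borel)) (\<lambda>\<xi>. \<lambda>j\<in>{1..d}. \<theta> j + \<sigma> * \<xi> j)"

definition estimators :: "nat \<Rightarrow> ((nat \<Rightarrow> real) \<Rightarrow> real) set" where
  "estimators d = borel_measurable (PiM {1..d} (\<lambda>_. borel))"

text \<open>The risk is an extended nonnegative real, since it may be infinite.\<close>

definition risk ::
    "nat \<Rightarrow> (nat \<Rightarrow> real) \<Rightarrow> real \<Rightarrow> ((nat \<Rightarrow> real) \<Rightarrow> real) \<Rightarrow> (nat \<Rightarrow> real) \<Rightarrow>
     (nat \<Rightarrow> real) measure \<Rightarrow> ennreal" where
  "risk d \<eta> \<sigma> T \<theta> Q = (\<integral>\<^sup>+ y. ennreal ((T y - lin_fun d \<eta> \<theta>)\<^sup>2) \<partial>(obs_law d \<sigma> \<theta> Q))"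

definition max_risk ::
    "nat \<Rightarrow> (nat \<Rightarrow> real) \<Rightarrow> real \<Rightarrow> real \<Rightarrow> real \<Rightarrow> ((nat \<Rightarrow> real) \<Rightarrow> real) \<Rightarrow> nat \<Rightarrow> ennreal" where
  "max_risk d \<eta> \<sigma> \<alpha> \<tau> T s =
     (SUP \<theta>\<in>sparse_class d s. SUP Q\<in>noise_prod_class d \<alpha> \<tau>. risk d \<eta> \<sigma> T \<theta> Q)"

section \<open>The rates\<close>

definition phi :: "nat \<Rightarrow> (nat \<Rightarrow> real) \<Rightarrow> real \<Rightarrow> real \<Rightarrow> real" where
  "phi d \<eta> \<alpha> \<beta> =
     (\<Sum>j=1..d. \<bar>\<eta> j\<bar> * exp (- \<beta> / \<bar>\<eta> j\<bar> powr \<alpha>)) /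
     sqrt (\<Sum>j=1..d. (\<eta> j)\<^sup>2 * exp (- \<beta> / \<bar>\<eta> j\<bar> powr \<alpha>))"

text \<open>
  For \<open>d \<ge> 1\<close> and nonzero \<open>\<eta>\<close>, \<^term>\<open>phi d \<eta> \<alpha>\<close> decreases continuously and strictly from
  \<open>+\<infinity>\<close> to \<open>0\<close>, so the definite descriptions below denote the unique solution whenever \<open>s \<ge> 1\<close>.
\<close>

definition beta_oracle :: "nat \<Rightarrow> (nat \<Rightarrow> real) \<Rightarrow> real \<Rightarrow> real \<Rightarrow> real" where
  "beta_oracle d \<eta> \<alpha> s = (THE \<beta>. phi d \<eta> \<alpha> \<beta> = s / 2)"

definition lambda_oracle :: "nat \<Rightarrow> (nat \<Rightarrow> real) \<Rightarrow> real \<Rightarrow> real \<Rightarrow> real" where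
  "lambda_oracle d \<eta> \<alpha> s = (max (beta_oracle d \<eta> \<alpha> s) 0) powr (1 / \<alpha>)"

definition nu_oracle :: "nat \<Rightarrow> (nat \<Rightarrow> real) \<Rightarrow> real \<Rightarrow> real \<Rightarrow> real" where
  "nu_oracle d \<eta> \<alpha> s =
     sqrt (\<Sum>j=1..d. (\<eta> j)\<^sup>2 * exp (- ((lambda_oracle d \<eta> \<alpha> s / \<bar>\<eta> j\<bar>) powr \<alpha>)))"

definition Phi_oracle :: "nat \<Rightarrow> (nat \<Rightarrow> real) \<Rightarrow> real \<Rightarrow> real \<Rightarrow> real" where
  "Phi_oracle d \<eta> \<alpha> s = (lambda_oracle d \<eta> \<alpha> s * s + nu_oracle d \<eta> \<alpha> s)\<^sup>2"

definition beta_star :: "nat \<Rightarrow> (nat \<Rightarrow> real) \<Rightarrow> real \<Rightarrow> real \<Rightarrow> real" where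
  "beta_star d \<eta> \<alpha> s = (THE \<beta>. phi d \<eta> \<alpha> \<beta> = s / (2 * sqrt (ln (exp 1 * s))))"

definition lambda_star :: "nat \<Rightarrow> (nat \<Rightarrow> real) \<Rightarrow> real \<Rightarrow> real \<Rightarrow> real" where
  "lambda_star d \<eta> \<alpha> s = (max (beta_star d \<eta> \<alpha> s) 0) powr (1 / \<alpha>)"

definition nu_star :: "nat \<Rightarrow> (nat \<Rightarrow> real) \<Rightarrow> real \<Rightarrow> real \<Rightarrow> real" where
  "nu_star d \<eta> \<alpha> s =
     sqrt (ln (exp 1 * s) *
       (\<Sum>j=1..d. (\<eta> j)\<^sup>2 * exp (- ((lambda_star d \<eta> \<alpha> s / \<bar>\<eta> j\<bar>) powr \<alpha>))))"

text \<open>Inserting \<open>0\<close> gives the value \<open>0\<close> when no \<open>s\<close> in \<open>{1..d}\<close> has positive threshold.\<close>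

definition s_star :: "nat \<Rightarrow> (nat \<Rightarrow> real) \<Rightarrow> real \<Rightarrow> nat" where
  "s_star d \<eta> \<alpha> = Max (insert 0 {s \<in> {1..d}. lambda_star d \<eta> \<alpha> (real s) > 0})"

definition s_zero :: "nat \<Rightarrow> (nat \<Rightarrow> real) \<Rightarrow> real \<Rightarrow> nat" where
  "s_zero d \<eta> \<alpha> = s_star d \<eta> \<alpha> + 1"

text \<open>Replacing \<open>s\<close> by \<open>min s s\<^sub>0\<close> makes the rate constant for \<open>s \<ge> s\<^sub>0\<close>.\<close>

definition Phi_star :: "nat \<Rightarrow> (nat \<Rightarrow> real) \<Rightarrow> real \<Rightarrow> real \<Rightarrow> real" where
  "Phi_star d \<eta> \<alpha> s =
     (let r = min s (real (s_zero d \<eta> \<alpha>))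
      in r\<^sup>2 * (lambda_star d \<eta> \<alpha> r)\<^sup>2 + (nu_star d \<eta> \<alpha> r)\<^sup>2)"

definition Phi_adp :: "nat \<Rightarrow> (nat \<Rightarrow> real) \<Rightarrow> real \<Rightarrow> real \<Rightarrow> real" where
  "Phi_adp d \<eta> \<alpha> s =
     (if \<alpha> < 2
      then max (Phi_star d \<eta> \<alpha> s)
               (Phi_star d \<eta> \<alpha> 1 * (ln (exp 1 * min s (real (s_zero d \<eta> \<alpha>))))\<^sup>2)
      else Phi_star d \<eta> \<alpha> s)"

end

theory Submission
  imports Defs "HOL-Real_Asymp.Real_Asymp"
begin

text \<open>
  Let every coordinate carry noise with density proportional to \<open>exp (- \<bar>b * x\<bar> powr \<alpha>)\<close>. Shifting
  coordinate \<open>j\<close> by \<open>c * (1 + t)\<close>, where \<open>t = \<lambda> / \<bar>\<eta> j\<bar>\<close>, costs a chi-square divergence of order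
  \<open>exp (t powr \<alpha>)\<close>. A random set \<open>B\<close> of coordinates is shifted in the direction \<open>sgn (\<eta> j)\<close>,
  independently with probabilities \<open>p j\<close> proportional to \<open>\<bar>\<eta> j\<bar> * exp (- (\<lambda> / \<bar>\<eta> j\<bar>) powr \<alpha>)\<close>. The
  defining equation of \<open>\<lambda>\<close> keeps the expected number of shifts below \<open>s / 2\<close>, the mean of \<open>L\<close> is of
  order \<open>\<lambda> * s + \<nu>\<close>, and the second moment of the likelihood ratio against the unshifted law is at
  most \<open>exp 1 * s powr \<gamma>\<close>: the logarithm in the adaptive rate is exactly what a second moment
  polynomial in \<open>s\<close> can afford. Hence an estimator that follows the mixture with error much smaller
  than \<open>\<lambda> * s + \<nu>\<close> has risk at least of order \<open>(\<lambda> * s + \<nu>)\<^sup>2 / s powr \<gamma>\<close> at the origin. The case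
  \<open>s = 1\<close> is the oracle bound, which also absorbs the logarithmic factors of the adaptive rate, being
  smaller than \<open>s powr \<gamma>\<close>.
\<close>

section \<open>The noise density\<close>

text \<open>If \<open>v\<close> is at most a small fraction of \<open>u\<close>, then
  \<open>u + v \<le> r * u\<close> with \<open>r powr \<alpha> = 3/2\<close>; otherwise both
  summands are controlled by \<open>v\<close>. The factor must stay below 2: in the chi-square
  integrand the shifted point carries the exponent factor -2, and \<open>- 2 + 3/2\<close> is still
  negative.\<close>

lemma powr_add_le:
  fixes \<alpha> :: real
  assumes "\<alpha> > 0"
  obtains A where "A > 0"
    "\<And>u v. 0 \<le> u \<Longrightarrow> 0 \<le> v \<Longrightarrow> (u + v) powr \<alpha> \<le> 3/2 * u powr \<alpha> + A * v powr \<alpha>"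
proof -
  define r :: real where "r = (3/2) powr (1/\<alpha>)"
  have r1: "r > 1" using assms unfolding r_def by (intro gr_one_powr) auto
  have r: "r powr \<alpha> = 3/2" using assms by (simp add: r_def powr_powr)
  define q where "q = 1 / (r - 1)"
  have q: "q > 0" using r1 by (simp add: q_def)
  show ?thesis
  proof (rule that)
    show "(1 + q) powr \<alpha> > 0" using q by simp
    fix u v :: real assume uv: "0 \<le> u" "0 \<le> v"
    show "(u + v) powr \<alpha> \<le> 3/2 * u powr \<alpha> + (1 + q) powr \<alpha> * v powr \<alpha>"
    proof (cases "u < q * v")
      case True
      then have "(u + v) powr \<alpha> \<le> ((1 + q) * v) powr \<alpha>"
        using uv assms by (intro powr_mono2) (auto simp: algebra_simps)
      also have "\<dots> = (1 + q) powr \<alpha> * v powr \<alpha>" using q uv by (simp add: powr_mult)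
      finally show ?thesis using powr_ge_zero[of u \<alpha>] by linarith
    next
      case False
      then have "v \<le> u * (r - 1)" using r1 by (simp add: q_def field_simps)
      then have "(u + v) powr \<alpha> \<le> (r * u) powr \<alpha>"
        using uv assms by (intro powr_mono2) (auto simp: algebra_simps)
      also have "\<dots> = 3/2 * u powr \<alpha>" using r1 uv by (simp add: powr_mult r)
      finally show ?thesis using mult_nonneg_nonneg[of "(1 + q) powr \<alpha>" "v powr \<alpha>"]
        by (smt (verit) powr_ge_zero)
    qed
  qed
qed

text \<open>The exponential beats any polynomial, so the integrand is at most a multiple of the
  integrable function \<open>inverse (1 + x\<^sup>2)\<close>. The weight
  \<open>1 + x\<^sup>2\<close> covers the mass and the second moment at once.\<close>

lemma integrable_exp_powr:
  fixes \<alpha> k :: real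
  assumes "\<alpha> > 0" "k > 0"
  shows "integrable lborel (\<lambda>x::real. (1 + x\<^sup>2) * exp (- (k * \<bar>x\<bar> powr \<alpha>)))"
proof -
  define g where "g x = (1 + x\<^sup>2)\<^sup>2 * exp (- (k * x powr \<alpha>))" for x :: real
  have "(g \<longlongrightarrow> 0) at_top" unfolding g_def using assms by real_asymp
  then have "eventually (\<lambda>x. g x < 1) at_top" by (rule order_tendstoD) simp
  then obtain N where N: "\<And>x. x \<ge> N \<Longrightarrow> g x < 1" by (auto simp: eventually_at_top_linorder)
  define C where "C = max 1 ((1 + N\<^sup>2)\<^sup>2)"
  have gC: "g x \<le> C" if "x \<ge> 0" for x
  proof (cases "x \<ge> N")
    case True
    then have "g x < 1" by (rule N)
    moreover have "1 \<le> C" by (simp add: C_def)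
    ultimately show ?thesis by linarith
  next
    case False
    then have "x\<^sup>2 \<le> N\<^sup>2" using that by (intro power_mono) auto
    then have "(1 + x\<^sup>2)\<^sup>2 \<le> (1 + N\<^sup>2)\<^sup>2" by (intro power_mono) auto
    moreover have "exp (- (k * x powr \<alpha>)) \<le> 1" using assms by simp
    ultimately have "g x \<le> (1 + N\<^sup>2)\<^sup>2 * 1" unfolding g_def by (intro mult_mono) auto
    then show ?thesis by (simp add: C_def)
  qed
  have "integrable lborel (\<lambda>x::real. C * inverse (1 + x\<^sup>2))"
    using integrable_inverse_1_plus_square by (simp add: set_integrable_def)
  then show ?thesis
  proof (rule Bochner_Integration.integrable_bound)
    show "AE x in lborel. norm ((1 + x\<^sup>2) * exp (- (k * \<bar>x\<bar> powr \<alpha>))) \<le> norm (C * inverse (1 + x\<^sup>2))"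
    proof (rule AE_I2)
      fix x :: real
      have pos: "1 + x\<^sup>2 > 0" by (simp add: add_pos_nonneg)
      have "(1 + x\<^sup>2) * exp (- (k * \<bar>x\<bar> powr \<alpha>)) = g \<bar>x\<bar> * inverse (1 + x\<^sup>2)"
        using pos by (simp add: g_def power2_eq_square field_simps)
      also have "\<dots> \<le> C * inverse (1 + x\<^sup>2)"
        using gC[of "\<bar>x\<bar>"] pos by (intro mult_right_mono) auto
      finally show "norm ((1 + x\<^sup>2) * exp (- (k * \<bar>x\<bar> powr \<alpha>))) \<le> norm (C * inverse (1 + x\<^sup>2))"
        using pos by (simp add: abs_mult C_def)
    qed
  qed simp
qed

text \<open>Markov's inequality for \<open>exp (k * \<bar>x\<bar> powr \<alpha>)\<close> gives a
  tail of the right shape with prefactor \<open>C\<close> instead of 2. A probability is at most its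
  own power \<delta> when \<open>0 < \<delta> \<le> 1\<close>, so a small power brings the prefactor
  down to 2; the loss in the rate is absorbed by a larger \<tau>.\<close>

lemma subexponential_density_in_noise_class:
  fixes \<alpha> k C :: real
  assumes "\<alpha> > 0" "k > 0"
    and [measurable]: "f \<in> borel_measurable borel"
    and pos: "\<And>x. f x \<ge> 0" and even: "\<And>x. f (- x) = f x"
    and mass: "has_bochner_integral lborel f 1"
    and var: "has_bochner_integral lborel (\<lambda>x. x\<^sup>2 * f x) 1"
    and exp_moment: "(\<integral>\<^sup>+x. ennreal (f x * exp (k * \<bar>x\<bar> powr \<alpha>)) \<partial>lborel) \<le> ennreal C"
  obtains \<tau>\<^sub>0 where "\<tau>\<^sub>0 > 0" "\<And>\<tau>. \<tau> \<ge> \<tau>\<^sub>0 \<Longrightarrow> density lborel (\<lambda>x. ennreal (f x)) \<in> noise_class \<alpha> \<tau>"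
proof -
  define P where "P = density lborel (\<lambda>x. ennreal (f x))"
  have [measurable_cong, simp]: "sets P = sets borel" by (simp add: P_def)
  have "emeasure P (space P) = (\<integral>\<^sup>+x. ennreal (f x) \<partial>lborel)"
    by (simp add: P_def emeasure_density)
  also have "\<dots> = 1"
    using mass pos by (simp add: has_bochner_integral_iff nn_integral_eq_integral)
  finally interpret prob_space P by (rule prob_spaceI)
  have sym: "distr P borel uminus = P"
  proof (rule measure_eqI)
    fix A assume "A \<in> sets (distr P borel uminus)"
    then have [measurable]: "A \<in> sets borel" by simp
    have [measurable]: "uminus -` A \<in> sets borel"
      using measurable_sets[of uminus borel borel A] by simp
    have "emeasure (distr P borel uminus) A = (\<integral>\<^sup>+x. ennreal (f x) * indicator (uminus -` A) x \<partial>lborel)"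
      by (simp add: emeasure_distr) (simp add: P_def emeasure_density)
    also have "\<dots> = (\<integral>\<^sup>+x. ennreal (f x) * indicator A x \<partial>lborel)"
      by (subst nn_integral_real_affine[where c="-1" and t=0])
        (auto simp: even indicator_def intro!: nn_integral_cong)
    also have "\<dots> = emeasure P A" by (simp add: P_def emeasure_density)
    finally show "emeasure (distr P borel uminus) A = emeasure P A" .
  qed simp
  have sq: "has_bochner_integral P (\<lambda>x. x\<^sup>2) 1"
    unfolding P_def using var pos by (intro has_bochner_integral_density) (auto simp: mult.commute)
  define C' where "C' = max C 1"
  \<comment> \<open>Chosen so that \<open>C' powr \<delta> \<le> 2\<close>. Taking the logarithm of
    \<open>C' + 1\<close> keeps the denominator positive when \<open>C' = 1\<close>.\<close>
  define \<delta> where "\<delta> = min 1 (ln 2 / ln (C' + 1))"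
  have C': "C' \<ge> 1" "C \<le> C'" by (auto simp: C'_def)
  then have lnC: "ln (C' + 1) > 0" by simp
  have \<delta>: "0 < \<delta>" "\<delta> \<le> 1" using lnC by (auto simp: \<delta>_def)
  have C'\<delta>: "C' powr \<delta> \<le> 2"
  proof -
    have "C' powr \<delta> \<le> (C' + 1) powr \<delta>" using C' \<delta> by (intro powr_mono2) auto
    also have "\<dots> \<le> (C' + 1) powr (ln 2 / ln (C' + 1))"
      using C' by (intro powr_mono) (auto simp: \<delta>_def)
    also have "\<dots> = 2" using C' lnC by (simp add: powr_def)
    finally show ?thesis .
  qed
  have tail: "measure P {x. \<bar>x\<bar> \<ge> t} \<le> 2 * exp (- (\<delta> * k * t powr \<alpha>))" if "t \<ge> 0" for t
  proof -
    have "emeasure P {x. \<bar>x\<bar> \<ge> t} = (\<integral>\<^sup>+x. ennreal (f x) * indicator {x. \<bar>x\<bar> \<ge> t} x \<partial>lborel)"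
      by (simp add: P_def emeasure_density)
    also have "\<dots> \<le> (\<integral>\<^sup>+x. ennreal (exp (- (k * t powr \<alpha>))) * ennreal (f x * exp (k * \<bar>x\<bar> powr \<alpha>)) \<partial>lborel)"
    proof (rule nn_integral_mono)
      fix x :: real
      show "ennreal (f x) * indicator {x. \<bar>x\<bar> \<ge> t} x \<le>
        ennreal (exp (- (k * t powr \<alpha>))) * ennreal (f x * exp (k * \<bar>x\<bar> powr \<alpha>))"
      proof (cases "\<bar>x\<bar> \<ge> t")
        case True
        then have "t powr \<alpha> \<le> \<bar>x\<bar> powr \<alpha>" using assms that by (intro powr_mono2) auto
        then have "1 \<le> exp (k * \<bar>x\<bar> powr \<alpha> - k * t powr \<alpha>)" using assms by simp
        then have "f x * 1 \<le> f x * exp (k * \<bar>x\<bar> powr \<alpha> - k * t powr \<alpha>)"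
          using pos by (intro mult_left_mono)
        then have "f x \<le> exp (- (k * t powr \<alpha>)) * (f x * exp (k * \<bar>x\<bar> powr \<alpha>))"
          by (simp add: exp_diff exp_minus field_simps)
        then have "ennreal (f x) \<le> ennreal (exp (- (k * t powr \<alpha>)) * (f x * exp (k * \<bar>x\<bar> powr \<alpha>)))"
          by (rule ennreal_leI)
        then show ?thesis using True pos by (simp add: ennreal_mult)
      qed simp
    qed
    also have "\<dots> \<le> ennreal (exp (- (k * t powr \<alpha>))) * ennreal C"
      by (subst nn_integral_cmult) (auto intro!: mult_left_mono exp_moment)
    also have "\<dots> \<le> ennreal (exp (- (k * t powr \<alpha>)) * C')"
      using C' by (subst ennreal_mult) (auto intro!: mult_left_mono ennreal_leI)
    finally have m: "measure P {x. \<bar>x\<bar> \<ge> t} \<le> exp (- (k * t powr \<alpha>)) * C'"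
      using C' by (simp add: emeasure_eq_measure)
    show ?thesis
    proof -
      define m where "m = measure P {x. \<bar>x\<bar> \<ge> t}"
      have m01: "0 \<le> m" "m \<le> 1" by (auto simp: m_def)
      have "m \<le> m powr \<delta>"
        using powr_mono'[of \<delta> 1 m] m01 \<delta> by simp
      also have "\<dots> \<le> (exp (- (k * t powr \<alpha>)) * C') powr \<delta>"
        using m m01 \<delta> by (intro powr_mono2) (auto simp: m_def)
      also have "\<dots> = exp (- (\<delta> * k * t powr \<alpha>)) * C' powr \<delta>"
        using C' by (simp add: powr_mult exp_powr_real mult_ac)
      also have "\<dots> \<le> exp (- (\<delta> * k * t powr \<alpha>)) * 2" using C'\<delta> by (intro mult_left_mono) auto
      finally show ?thesis by (simp add: m_def mult_ac)
    qed
  qed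
  \<comment> \<open>\<open>\<tau>\<^sub>0\<close> solves
    \<open>2 / \<tau> powr \<alpha> = \<delta> * k\<close>; for larger \<tau> the class asks for a
    slower decay than the one just shown.\<close>
  define \<tau>\<^sub>0 where "\<tau>\<^sub>0 = (2 / (\<delta> * k)) powr (1 / \<alpha>)"
  have \<tau>\<^sub>0: "\<tau>\<^sub>0 > 0" using \<delta> assms by (simp add: \<tau>\<^sub>0_def)
  have "P \<in> noise_class \<alpha> \<tau>" if \<tau>: "\<tau> \<ge> \<tau>\<^sub>0" for \<tau>
  proof -
    have "2 * (t / \<tau>) powr \<alpha> \<le> \<delta> * k * t powr \<alpha>" if "t \<ge> 0" for t
    proof -
      have "2 / (\<delta> * k) = \<tau>\<^sub>0 powr \<alpha>" using assms \<delta> by (simp add: \<tau>\<^sub>0_def powr_powr)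
      also have "\<dots> \<le> \<tau> powr \<alpha>" using \<tau> \<tau>\<^sub>0 assms by (intro powr_mono2) auto
      finally have "2 \<le> \<delta> * k * \<tau> powr \<alpha>" using \<delta> assms by (simp add: field_simps)
      then have "2 * t powr \<alpha> \<le> \<delta> * k * \<tau> powr \<alpha> * t powr \<alpha>" by (intro mult_right_mono) auto
      then show ?thesis using \<tau> \<tau>\<^sub>0 that by (simp add: powr_divide field_simps)
    qed
    then have "2 * exp (- (\<delta> * k * t powr \<alpha>)) \<le> 2 * exp (- 2 * (t / \<tau>) powr \<alpha>)" if "t \<ge> 0" for t
      using that by simp
    then have "measure P {x. \<bar>x\<bar> \<ge> t} \<le> 2 * exp (- 2 * (t / \<tau>) powr \<alpha>)" if "t \<ge> 0" for t
      using tail that order_trans by blast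
    with sym sq show ?thesis by (simp add: noise_class_def prob_space_axioms)
  qed
  with \<tau>\<^sub>0 show ?thesis using that unfolding P_def by blast
qed

text \<open>The witness is the density proportional to
  \<open>exp (- \<bar>b * x\<bar> powr \<alpha>)\<close> with unit variance. Its tails are as heavy
  as the class permits up to constants, so a shift of order \<open>1 + t\<close> costs a chi-square
  factor of only \<open>exp (t powr \<alpha>)\<close>.\<close>

lemma exists_noise_density:
  fixes \<alpha> :: real
  assumes \<alpha>: "\<alpha> > 0"
  obtains f :: "real \<Rightarrow> real" and \<tau>\<^sub>0 c K :: real
  where "\<tau>\<^sub>0 > 0" "c > 0" "K > 0" "f \<in> borel_measurable borel" "\<And>x. f x > 0"
    "\<And>\<tau>. \<tau> \<ge> \<tau>\<^sub>0 \<Longrightarrow> density lborel (\<lambda>x. ennreal (f x)) \<in> noise_class \<alpha> \<tau>"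
    "\<And>t \<delta>. t \<ge> 0 \<Longrightarrow> \<bar>\<delta>\<bar> = c * (1 + t) \<Longrightarrow>
      (\<integral>\<^sup>+x. ennreal ((f (x - \<delta>))\<^sup>2 / f x) \<partial>lborel) \<le> ennreal (K * exp (t powr \<alpha>))"
proof -
  define h where "h k x = exp (- (k * \<bar>x\<bar> powr \<alpha>))" for k x :: real
  have h_meas[measurable]: "h k \<in> borel_measurable borel" for k
    unfolding h_def by measurable
  have h_pos: "h k x > 0" for k x by (simp add: h_def)
  have int1: "integrable lborel (h k)" if "k > 0" for k
    using integrable_exp_powr[OF \<alpha> that]
    by (rule Bochner_Integration.integrable_bound)
      (auto simp: h_def intro!: AE_I2 mult_left_le_one_le simp: mult_le_cancel_right1)
  have int2: "integrable lborel (\<lambda>x. x\<^sup>2 * h k x)" if "k > 0" for k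
    using integrable_exp_powr[OF \<alpha> that]
    by (rule Bochner_Integration.integrable_bound)
      (auto simp: h_def abs_mult intro!: AE_I2 mult_right_mono)
  have pos_integral: "(\<integral>x. g x \<partial>lborel) > 0"
    if "integrable lborel g" "\<And>x. x \<noteq> 0 \<Longrightarrow> g x > 0" "\<And>x. g x \<ge> 0" for g :: "real \<Rightarrow> real"
  proof -
    have "(\<integral>x. g x \<partial>lborel) \<noteq> 0"
    proof
      assume "(\<integral>x. g x \<partial>lborel) = 0"
      then have "AE x in lborel. g x = 0"
        using that by (subst (asm) integral_nonneg_eq_0_iff_AE) auto
      moreover have "AE x in lborel. x \<noteq> (0::real)" by (rule AE_lborel_singleton)
      ultimately have "AE x in (lborel::real measure). False"
        by eventually_elim (use that(2) in force)
      then show False by (simp add: ae_filter_eq_bot_iff)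
    qed
    moreover have "(\<integral>x. g x \<partial>lborel) \<ge> 0" using that by simp
    ultimately show ?thesis by simp
  qed
  \<comment> \<open>\<open>Z\<close> is the total mass of
    \<open>exp (- \<bar>x\<bar> powr \<alpha>)\<close> and \<open>b\<close> the standard deviation
    after normalisation, so rescaling by \<open>b\<close> yields unit variance.\<close>
  define Z where "Z = (\<integral>x. h 1 x \<partial>lborel)"
  define b where "b = sqrt ((\<integral>x. x\<^sup>2 * h 1 x \<partial>lborel) / Z)"
  have Z: "Z > 0" unfolding Z_def using h_pos by (intro pos_integral int1) (auto intro: less_imp_le)
  have m2: "(\<integral>x. x\<^sup>2 * h 1 x \<partial>lborel) > 0"
    using h_pos by (intro pos_integral int2) (auto simp: h_def)
  have b: "b > 0" using Z m2 by (simp add: b_def)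
  have b2: "b\<^sup>2 * Z = (\<integral>x. x\<^sup>2 * h 1 x \<partial>lborel)" using Z m2 by (simp add: b_def)
  define f where "f x = b / Z * h (b powr \<alpha>) x" for x
  have h_scale: "h 1 (b * x) = h (b powr \<alpha>) x" for x
    using b by (simp add: h_def abs_mult powr_mult)
  have f_pos: "f x > 0" for x using b Z h_pos by (simp add: f_def)
  have f_meas[measurable]: "f \<in> borel_measurable borel" unfolding f_def by measurable
  have k: "b powr \<alpha> > 0" using b by simp
  have mass: "has_bochner_integral lborel f 1"
  proof -
    have *: "Z = b * (\<integral>x. h (b powr \<alpha>) x \<partial>lborel)"
      using lborel_integral_real_affine[of b "h 1" 0] b by (simp add: Z_def h_scale)
    have "b / Z * (\<integral>x. h (b powr \<alpha>) x \<partial>lborel) = (b * (\<integral>x. h (b powr \<alpha>) x \<partial>lborel)) / Z" by simp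
    also have "\<dots> = 1" unfolding *[symmetric] using Z by simp
    finally have "b / Z * (\<integral>x. h (b powr \<alpha>) x \<partial>lborel) = 1" .
    moreover have "has_bochner_integral lborel (\<lambda>x. b / Z * h (b powr \<alpha>) x) (b / Z * (\<integral>x. h (b powr \<alpha>) x \<partial>lborel))"
      by (intro has_bochner_integral_mult_right has_bochner_integral_integrable int1 k)
    ultimately show ?thesis by (simp only: f_def [abs_def])
  qed
  have var: "has_bochner_integral lborel (\<lambda>x. x\<^sup>2 * f x) 1"
  proof -
    have "b\<^sup>2 * Z = b * (\<integral>x. b\<^sup>2 * (x\<^sup>2 * h (b powr \<alpha>) x) \<partial>lborel)"
      using lborel_integral_real_affine[of b "\<lambda>x. x\<^sup>2 * h 1 x" 0] b
      by (simp add: b2 h_scale power_mult_distrib mult.assoc)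
    then have *: "Z = b * (\<integral>x. x\<^sup>2 * h (b powr \<alpha>) x \<partial>lborel)"
      using b by simp
    have eq: "(\<lambda>x. x\<^sup>2 * f x) = (\<lambda>x. b / Z * (x\<^sup>2 * h (b powr \<alpha>) x))" by (auto simp: f_def)
    have "b / Z * (\<integral>x. x\<^sup>2 * h (b powr \<alpha>) x \<partial>lborel) = (b * (\<integral>x. x\<^sup>2 * h (b powr \<alpha>) x \<partial>lborel)) / Z" by simp
    also have "\<dots> = 1" unfolding *[symmetric] using Z by simp
    finally have "b / Z * (\<integral>x. x\<^sup>2 * h (b powr \<alpha>) x \<partial>lborel) = 1" .
    moreover have "has_bochner_integral lborel (\<lambda>x. b / Z * (x\<^sup>2 * h (b powr \<alpha>) x)) (b / Z * (\<integral>x. x\<^sup>2 * h (b powr \<alpha>) x \<partial>lborel))"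
      by (intro has_bochner_integral_mult_right has_bochner_integral_integrable int2 k)
    ultimately show ?thesis by (simp only: eq)
  qed
  \<comment> \<open>Half the decay rate of \<open>f\<close> serves twice:
    \<open>f x * exp (k * \<bar>x\<bar> powr \<alpha>)\<close> still decays at rate
    \<open>k\<close>, which gives the exponential moment, and rate \<open>k\<close> is also what
    remains in the chi-square integrand below.\<close>
  define k where "k = b powr \<alpha> / 2"
  have k0: "k > 0" using k by (simp add: k_def)
  define J where "J = (\<integral>x. h k x \<partial>lborel)"
  have J: "J > 0" unfolding J_def using h_pos k0 by (intro pos_integral int1) (auto intro: less_imp_le)
  have hJ: "(\<integral>\<^sup>+x. ennreal (h k x) \<partial>lborel) = ennreal J"
    using int1[OF k0] h_pos by (simp add: J_def nn_integral_eq_integral less_imp_le)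
  have "(\<integral>\<^sup>+x. ennreal (f x * exp (k * \<bar>x\<bar> powr \<alpha>)) \<partial>lborel) = (\<integral>\<^sup>+x. ennreal (b / Z) * ennreal (h k x) \<partial>lborel)"
  proof (rule nn_integral_cong)
    fix x :: real
    have "f x * exp (k * \<bar>x\<bar> powr \<alpha>) = b / Z * h k x"
      by (simp add: f_def h_def k_def flip: exp_add)
    moreover have "ennreal (b / Z * h k x) = ennreal (b / Z) * ennreal (h k x)"
      using b Z h_pos[of k x] by (intro ennreal_mult) auto
    ultimately show "ennreal (f x * exp (k * \<bar>x\<bar> powr \<alpha>)) = ennreal (b / Z) * ennreal (h k x)"
      by simp
  qed
  also have "\<dots> = ennreal (b / Z) * ennreal J" by (simp add: nn_integral_cmult hJ)
  also have "\<dots> = ennreal (b / Z * J)" using b Z J by (intro ennreal_mult[symmetric]) auto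
  finally have "(\<integral>\<^sup>+x. ennreal (f x * exp (k * \<bar>x\<bar> powr \<alpha>)) \<partial>lborel) \<le> ennreal (b / Z * J)" by simp
  then obtain \<tau>\<^sub>0 where \<tau>\<^sub>0: "\<tau>\<^sub>0 > 0"
    "\<And>\<tau>. \<tau> \<ge> \<tau>\<^sub>0 \<Longrightarrow> density lborel (\<lambda>x. ennreal (f x)) \<in> noise_class \<alpha> \<tau>"
    using f_pos mass var
    by (elim subexponential_density_in_noise_class[OF \<alpha> k0 f_meas, rotated -1])
      (auto simp: f_def h_def less_imp_le)
  obtain A where A: "A > 0"
    "\<And>u v. 0 \<le> u \<Longrightarrow> 0 \<le> v \<Longrightarrow> (u + v) powr \<alpha> \<le> 3/2 * u powr \<alpha> + A * v powr \<alpha>"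
    using powr_add_le[OF \<alpha>] by blast
  define B where "B = b powr \<alpha> * A"
  have B: "B > 0" using A k by (simp add: B_def)
  \<comment> \<open>The exponent of the integrand is \<open>- 2 * \<bar>x - \<delta>\<bar> powr
    \<alpha> + \<bar>x\<bar> powr \<alpha>\<close> times \<open>b powr \<alpha>\<close>. The 3/2
    bound on the second term leaves \<open>- k * \<bar>x - \<delta>\<bar> powr \<alpha>\<close>,
    whose exponential integrates to \<open>J\<close> for every \<delta>, and a factor depending on
    \<delta> alone.\<close>
  have chi: "(\<integral>\<^sup>+x. ennreal ((f (x - \<delta>))\<^sup>2 / f x) \<partial>lborel) \<le> ennreal (b / Z * J * exp (B * \<bar>\<delta>\<bar> powr \<alpha>))" for \<delta>
  proof -
    have "(f (x - \<delta>))\<^sup>2 / f x \<le> b / Z * exp (B * \<bar>\<delta>\<bar> powr \<alpha>) * h k (x - \<delta>)" for x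
    proof -
      have "\<bar>x\<bar> powr \<alpha> \<le> (\<bar>x - \<delta>\<bar> + \<bar>\<delta>\<bar>) powr \<alpha>" using \<alpha> by (intro powr_mono2) auto
      also have "\<dots> \<le> 3/2 * \<bar>x - \<delta>\<bar> powr \<alpha> + A * \<bar>\<delta>\<bar> powr \<alpha>" by (intro A) auto
      finally have "b powr \<alpha> * \<bar>x\<bar> powr \<alpha> \<le> b powr \<alpha> * (3/2 * \<bar>x - \<delta>\<bar> powr \<alpha> + A * \<bar>\<delta>\<bar> powr \<alpha>)"
        using k by (intro mult_left_mono) auto
      then have "- 2 * (b powr \<alpha> * \<bar>x - \<delta>\<bar> powr \<alpha>) + b powr \<alpha> * \<bar>x\<bar> powr \<alpha> \<le>
          B * \<bar>\<delta>\<bar> powr \<alpha> - k * \<bar>x - \<delta>\<bar> powr \<alpha>"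
        by (simp add: B_def k_def algebra_simps)
      then have "exp (- 2 * (b powr \<alpha> * \<bar>x - \<delta>\<bar> powr \<alpha>) + b powr \<alpha> * \<bar>x\<bar> powr \<alpha>) \<le>
          exp (B * \<bar>\<delta>\<bar> powr \<alpha>) * h k (x - \<delta>)"
        by (simp add: h_def flip: exp_add)
      moreover have "(f (x - \<delta>))\<^sup>2 / f x =
          b / Z * exp (- 2 * (b powr \<alpha> * \<bar>x - \<delta>\<bar> powr \<alpha>) + b powr \<alpha> * \<bar>x\<bar> powr \<alpha>)"
      proof -
        have e: "(exp (- u))\<^sup>2 / exp (- v) = exp (- 2 * u + v)" for u v :: real
          by (simp add: power2_eq_square flip: exp_add exp_diff)
        have "(a * u)\<^sup>2 / (a * v) = a * (u\<^sup>2 / v)" if "a > 0" for a u v :: real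
          using that by (simp add: power2_eq_square)
        from this[of "b / Z"] show ?thesis
          using b Z by (simp only: f_def h_def e zero_less_divide_iff simp_thms)
      qed
      moreover have "b / Z \<ge> 0" using b Z by simp
      ultimately show ?thesis by (metis mult.assoc mult_left_mono)
    qed
    then have "(\<integral>\<^sup>+x. ennreal ((f (x - \<delta>))\<^sup>2 / f x) \<partial>lborel) \<le>
        (\<integral>\<^sup>+x. ennreal (b / Z * exp (B * \<bar>\<delta>\<bar> powr \<alpha>)) * ennreal (h k (x - \<delta>)) \<partial>lborel)"
      using b Z h_pos by (intro nn_integral_mono) (simp add: less_imp_le flip: ennreal_mult)
    also have "\<dots> = ennreal (b / Z * exp (B * \<bar>\<delta>\<bar> powr \<alpha>)) * (\<integral>\<^sup>+x. ennreal (h k (x - \<delta>)) \<partial>lborel)"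
      by (simp add: nn_integral_cmult)
    also have "(\<integral>\<^sup>+x. ennreal (h k (x - \<delta>)) \<partial>lborel) = ennreal J"
      using nn_integral_real_affine[of "\<lambda>x. ennreal (h k x)" 1 "- \<delta>"] by (simp add: hJ)
    also have "ennreal (b / Z * exp (B * \<bar>\<delta>\<bar> powr \<alpha>)) * ennreal J = ennreal (b / Z * J * exp (B * \<bar>\<delta>\<bar> powr \<alpha>))"
    proof -
      have "ennreal (b / Z * exp (B * \<bar>\<delta>\<bar> powr \<alpha>)) * ennreal J = ennreal (b / Z * exp (B * \<bar>\<delta>\<bar> powr \<alpha>) * J)"
        using b Z J by (intro ennreal_mult[symmetric]) auto
      then show ?thesis by (simp only: mult_ac)
    qed
    finally show ?thesis .
  qed
  \<comment> \<open>\<open>(2 * c) powr \<alpha> = 1 / B\<close> and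
    \<open>1 + t \<le> 2 * max 1 t\<close>, so the exponent is at most
    \<open>max 1 t powr \<alpha> \<le> 1 + t powr \<alpha>\<close>; the summand 1 becomes the factor
    \<open>exp 1\<close> of the final constant.\<close>
  define c where "c = (1 / B) powr (1 / \<alpha>) / 2"
  have c: "c > 0" using B by (simp add: c_def)
  have "B * \<bar>\<delta>\<bar> powr \<alpha> \<le> 1 + t powr \<alpha>" if "t \<ge> 0" "\<bar>\<delta>\<bar> = c * (1 + t)" for t \<delta>
  proof -
    have "\<bar>\<delta>\<bar> powr \<alpha> \<le> (2 * c * max 1 t) powr \<alpha>"
      using that c \<alpha> by (intro powr_mono2) (auto simp: max_def algebra_simps)
    also have "\<dots> = 1 / B * (max 1 t) powr \<alpha>"
      using B \<alpha> by (simp add: c_def powr_mult powr_powr powr_divide)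
    finally have "B * \<bar>\<delta>\<bar> powr \<alpha> \<le> (max 1 t) powr \<alpha>" using B by (simp add: field_simps)
    also have "\<dots> \<le> 1 + t powr \<alpha>" by (auto simp: max_def)
    finally show ?thesis .
  qed
  then have "b / Z * J * exp (B * \<bar>\<delta>\<bar> powr \<alpha>) \<le> b / Z * J * exp 1 * exp (t powr \<alpha>)"
    if "t \<ge> 0" "\<bar>\<delta>\<bar> = c * (1 + t)" for t \<delta>
    using that b Z J by (auto simp: mult.assoc simp flip: exp_add intro!: mult_left_mono divide_right_mono)
  then have "(\<integral>\<^sup>+x. ennreal ((f (x - \<delta>))\<^sup>2 / f x) \<partial>lborel) \<le> ennreal (b / Z * J * exp 1 * exp (t powr \<alpha>))"
    if "t \<ge> 0" "\<bar>\<delta>\<bar> = c * (1 + t)" for t \<delta>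
    using that by (intro order_trans[OF chi] ennreal_leI) auto
  with \<tau>\<^sub>0 c f_pos f_meas b Z J show ?thesis
    by (intro that[of \<tau>\<^sub>0 c "b / Z * J * exp 1" f]) auto
qed

section \<open>A constrained risk inequality\<close>

text \<open>Likelihood ratio form of a translation. The image of the product law under the shift and
  the product law reweighted by the ratios both agree on rectangles with the product
  \<open>PiM I M\<close> of the shifted marginals, hence both equal it.\<close>

lemma nn_integral_PiM_shift:
  fixes f :: "real \<Rightarrow> real" and \<delta> :: "'i \<Rightarrow> real" and h :: "('i \<Rightarrow> real) \<Rightarrow> ennreal"
  defines "P \<equiv> density lborel (\<lambda>x. ennreal (f x))"
  assumes I: "finite I" and [measurable]: "f \<in> borel_measurable borel" and f: "\<And>x. f x > 0"
    and P: "prob_space P" and h[measurable]: "h \<in> borel_measurable (PiM I (\<lambda>_. borel))"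
  shows "(\<integral>\<^sup>+x. h (\<lambda>j\<in>I. \<delta> j + x j) \<partial>PiM I (\<lambda>_. P)) =
    (\<integral>\<^sup>+x. (\<Prod>j\<in>I. ennreal (f (x j - \<delta> j) / f (x j))) * h x \<partial>PiM I (\<lambda>_. P))"
proof -
  interpret P: prob_space P by fact
  have [measurable_cong, simp]: "sets P = sets borel" by (simp add: P_def)
  have [simp]: "space P = UNIV" by (simp add: P_def)
  have setsPM[measurable_cong, simp]: "sets (PiM I (\<lambda>_. P)) = sets (PiM I (\<lambda>_. borel))"
    by (intro sets_PiM_cong) auto
  define M where "M j = distr P borel ((+) (\<delta> j))" for j
  have M: "prob_space (M j)" for j
    unfolding M_def by (intro P.prob_space_distr) auto
  interpret PM: product_sigma_finite M
    using M by (simp add: product_sigma_finite_def prob_space_imp_sigma_finite)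
  interpret PP: product_sigma_finite "\<lambda>_. P"
    by (simp add: product_sigma_finite_def P.sigma_finite_measure_axioms)
  have setsM[simp]: "sets (M j) = sets borel" for j by (simp add: M_def)
  have setsMM: "sets (PiM I M) = sets (PiM I (\<lambda>_. borel))" by (intro sets_PiM_cong) auto
  have shift: "emeasure (M j) A = (\<integral>\<^sup>+x. ennreal (f (x - \<delta> j) / f x) * indicator A x \<partial>P)"
    if [measurable]: "A \<in> sets borel" for A j
  proof -
    have [measurable]: "(+) (\<delta> j) -` A \<in> sets borel"
      using measurable_sets[of "(+) (\<delta> j)" borel borel A] by simp
    have "emeasure (M j) A = emeasure P ((+) (\<delta> j) -` A)"
      by (simp add: M_def emeasure_distr)
    also have "\<dots> = (\<integral>\<^sup>+x. ennreal (f x) * indicator A (\<delta> j + x) \<partial>lborel)"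
      by (simp add: P_def emeasure_density indicator_def)
    also have "\<dots> = (\<integral>\<^sup>+x. ennreal (f (x - \<delta> j)) * indicator A x \<partial>lborel)"
      by (subst nn_integral_real_affine[where c=1 and t="- \<delta> j"]) auto
    also have "\<dots> = (\<integral>\<^sup>+x. ennreal (f x) * (ennreal (f (x - \<delta> j) / f x) * indicator A x) \<partial>lborel)"
    proof (rule nn_integral_cong)
      fix x
      have "f (x - \<delta> j) = f x * (f (x - \<delta> j) / f x)" using f[of x] by simp
      then have "ennreal (f (x - \<delta> j)) = ennreal (f x) * ennreal (f (x - \<delta> j) / f x)"
        using f[of x] f[of "x - \<delta> j"] by (metis divide_nonneg_pos ennreal_mult less_imp_le)
      then show "ennreal (f (x - \<delta> j)) * indicator A x =
          ennreal (f x) * (ennreal (f (x - \<delta> j) / f x) * indicator A x)"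
        by (simp add: mult.assoc)
    qed
    also have "\<dots> = (\<integral>\<^sup>+x. ennreal (f (x - \<delta> j) / f x) * indicator A x \<partial>P)"
      by (simp add: P_def nn_integral_density)
    finally show ?thesis .
  qed
  have meas_shift: "(\<lambda>x. \<lambda>j\<in>I. \<delta> j + x j) \<in> measurable (PiM I (\<lambda>_. P)) (PiM I (\<lambda>_. borel))"
    by measurable
  have 1: "distr (PiM I (\<lambda>_. P)) (PiM I (\<lambda>_. borel)) (\<lambda>x. \<lambda>j\<in>I. \<delta> j + x j) = PiM I M"
  proof (rule PM.PiM_eqI[OF I])
    fix A assume A: "\<And>i. i \<in> I \<Longrightarrow> A i \<in> sets (M i)"
    then have "Pi\<^sub>E I A \<in> sets (PiM I (\<lambda>_. borel))" by (intro sets_PiM_I_finite I) auto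
    then have "emeasure (distr (PiM I (\<lambda>_. P)) (PiM I (\<lambda>_. borel)) (\<lambda>x. \<lambda>j\<in>I. \<delta> j + x j)) (Pi\<^sub>E I A) =
      emeasure (PiM I (\<lambda>_. P)) ((\<lambda>x. \<lambda>j\<in>I. \<delta> j + x j) -` Pi\<^sub>E I A \<inter> space (PiM I (\<lambda>_. P)))"
      using meas_shift by (intro emeasure_distr)
    also have "(\<lambda>x. \<lambda>j\<in>I. \<delta> j + x j) -` Pi\<^sub>E I A \<inter> space (PiM I (\<lambda>_. P)) = Pi\<^sub>E I (\<lambda>j. (+) (\<delta> j) -` A j)"
      by (auto simp: space_PiM PiE_iff)
    also have "emeasure (PiM I (\<lambda>_. P)) \<dots> = (\<Prod>j\<in>I. emeasure P ((+) (\<delta> j) -` A j))"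
    proof (rule PP.emeasure_PiM[OF I])
      fix i assume "i \<in> I"
      then have "A i \<in> sets borel" using A by simp
      then show "(+) (\<delta> i) -` A i \<in> sets P"
        using measurable_sets[of "(+) (\<delta> i)" borel borel "A i"] by simp
    qed
    also have "\<dots> = (\<Prod>j\<in>I. emeasure (M j) (A j))"
      using A by (intro prod.cong) (auto simp: M_def emeasure_distr)
    finally show "emeasure (distr (PiM I (\<lambda>_. P)) (PiM I (\<lambda>_. borel)) (\<lambda>x. \<lambda>j\<in>I. \<delta> j + x j)) (Pi\<^sub>E I A) =
      (\<Prod>j\<in>I. emeasure (M j) (A j))" .
  qed (simp add: setsMM)
  have 2: "density (PiM I (\<lambda>_. P)) (\<lambda>x. \<Prod>j\<in>I. ennreal (f (x j - \<delta> j) / f (x j))) = PiM I M"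
  proof (rule PM.PiM_eqI[OF I])
    fix A assume "\<And>i. i \<in> I \<Longrightarrow> A i \<in> sets (M i)"
    then have A[measurable]: "i \<in> I \<Longrightarrow> A i \<in> sets borel" for i by simp
    then have [measurable]: "Pi\<^sub>E I A \<in> sets (PiM I (\<lambda>_. borel))" by (intro sets_PiM_I_finite I) auto
    have "emeasure (density (PiM I (\<lambda>_. P)) (\<lambda>x. \<Prod>j\<in>I. ennreal (f (x j - \<delta> j) / f (x j)))) (Pi\<^sub>E I A) =
      (\<integral>\<^sup>+x. (\<Prod>j\<in>I. ennreal (f (x j - \<delta> j) / f (x j))) * indicator (Pi\<^sub>E I A) x \<partial>PiM I (\<lambda>_. P))"
      by (subst emeasure_density) auto
    also have "\<dots> = (\<integral>\<^sup>+x. (\<Prod>j\<in>I. ennreal (f (x j - \<delta> j) / f (x j)) * indicator (A j) (x j)) \<partial>PiM I (\<lambda>_. P))"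
    proof (rule nn_integral_cong)
      fix x assume "x \<in> space (PiM I (\<lambda>_. P))"
      then have "x \<in> extensional I" by (auto simp: space_PiM PiE_iff)
      then have "(indicator (Pi\<^sub>E I A) x :: ennreal) = (\<Prod>j\<in>I. indicator (A j) (x j))"
        using I by (auto simp: indicator_def PiE_iff intro!: prod.neutral[symmetric] prod_zero[symmetric])
      then show "(\<Prod>j\<in>I. ennreal (f (x j - \<delta> j) / f (x j))) * indicator (Pi\<^sub>E I A) x =
        (\<Prod>j\<in>I. ennreal (f (x j - \<delta> j) / f (x j)) * indicator (A j) (x j))"
        by (simp add: prod.distrib)
    qed
    also have "\<dots> = (\<Prod>j\<in>I. \<integral>\<^sup>+x. ennreal (f (x - \<delta> j) / f x) * indicator (A j) x \<partial>P)"
      by (rule PP.product_nn_integral_prod[OF I]) auto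
    also have "\<dots> = (\<Prod>j\<in>I. emeasure (M j) (A j))"
      by (intro prod.cong) (auto simp: shift)
    finally show "emeasure (density (PiM I (\<lambda>_. P)) (\<lambda>x. \<Prod>j\<in>I. ennreal (f (x j - \<delta> j) / f (x j)))) (Pi\<^sub>E I A) =
      (\<Prod>j\<in>I. emeasure (M j) (A j))" .
  qed (simp add: setsMM)
  have "(\<integral>\<^sup>+x. h (\<lambda>j\<in>I. \<delta> j + x j) \<partial>PiM I (\<lambda>_. P)) = (\<integral>\<^sup>+x. h x \<partial>PiM I M)"
    using meas_shift by (subst 1[symmetric], subst nn_integral_distr) auto
  also have "\<dots> = (\<integral>\<^sup>+x. (\<Prod>j\<in>I. ennreal (f (x j - \<delta> j) / f (x j))) * h x \<partial>PiM I (\<lambda>_. P))"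
    by (subst 2[symmetric], subst nn_integral_density) auto
  finally show ?thesis .
qed

text \<open>The probability that a random subset of \<open>I\<close>, containing each
  \<open>j\<close> independently with probability \<open>p j\<close>, equals
  \<open>B\<close>.\<close>

definition bernoulli_weight :: "'i set \<Rightarrow> ('i \<Rightarrow> real) \<Rightarrow> 'i set \<Rightarrow> real" where
  "bernoulli_weight I p B = (\<Prod>j\<in>B. p j) * (\<Prod>j\<in>I - B. 1 - p j)"

text \<open>Expand the product of \<open>p j + q j\<close> over \<open>I\<close>, where
  \<open>q\<close> vanishes on \<open>J\<close>: subsets missing a point of \<open>J\<close>
  contribute nothing, and the factors outside \<open>J\<close> are 1. Taking \<open>J\<close> empty,
  a singleton or a pair gives the total mass, the marginals and the pairwise independence.\<close>

lemma sum_bernoulli_weight_superset: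
  assumes I: "finite I" and J: "J \<subseteq> I"
  shows "(\<Sum>B | B \<subseteq> I \<and> J \<subseteq> B. bernoulli_weight I p B) = (\<Prod>j\<in>J. p j)"
proof -
  define q where "q j = (if j \<in> J then 0 else 1 - p j)" for j
  have "(\<Prod>j\<in>J. p j) = (\<Prod>j\<in>I. p j + q j)"
    using I J by (intro prod.mono_neutral_cong_left) (auto simp: q_def)
  also have "\<dots> = (\<Sum>B\<in>Pow I. (\<Prod>j\<in>B. p j) * (\<Prod>j\<in>I - B. q j))"
    by (rule prod_add[OF I])
  also have "\<dots> = (\<Sum>B | B \<subseteq> I \<and> J \<subseteq> B. bernoulli_weight I p B)"
  proof (rule sum.mono_neutral_cong_right)
    show "\<forall>B\<in>Pow I - {B. B \<subseteq> I \<and> J \<subseteq> B}. (\<Prod>j\<in>B. p j) * (\<Prod>j\<in>I - B. q j) = 0"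
    proof
      fix B assume "B \<in> Pow I - {B. B \<subseteq> I \<and> J \<subseteq> B}"
      then obtain j where "j \<in> J" "j \<notin> B" by auto
      then have "(\<Prod>j\<in>I - B. q j) = 0" using I J by (intro prod_zero) (auto simp: q_def)
      then show "(\<Prod>j\<in>B. p j) * (\<Prod>j\<in>I - B. q j) = 0" by simp
    qed
    fix B assume "B \<in> {B. B \<subseteq> I \<and> J \<subseteq> B}"
    then have "(\<Prod>j\<in>I - B. q j) = (\<Prod>j\<in>I - B. 1 - p j)"
      by (intro prod.cong) (auto simp: q_def)
    then show "(\<Prod>j\<in>B. p j) * (\<Prod>j\<in>I - B. q j) = bernoulli_weight I p B"
      by (simp add: bernoulli_weight_def)
  qed (use I in auto)
  finally show ?thesis ..
qed

lemma bernoulli_weight_nonneg: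
  assumes "B \<subseteq> I" "\<And>j. j \<in> I \<Longrightarrow> 0 \<le> p j \<and> p j \<le> 1"
  shows "bernoulli_weight I p B \<ge> 0"
  unfolding bernoulli_weight_def using assms by (intro mult_nonneg_nonneg prod_nonneg) auto

text \<open>A Markov bound under the measure conditioned on \<open>j \<in> B\<close>.\<close>

lemma bernoulli_weight_truncated_marginal:
  assumes I: "finite I" and p: "\<And>j. j \<in> I \<Longrightarrow> 0 \<le> p j \<and> p j \<le> 1"
    and sum: "(\<Sum>j\<in>I. p j) \<le> real s / 2" and s: "s \<ge> 1" and j: "j \<in> I"
  shows "p j / 2 \<le> (\<Sum>B | B \<subseteq> I \<and> card B \<le> s \<and> j \<in> B. bernoulli_weight I p B)"
proof -
  let ?w = "bernoulli_weight I p"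
  let ?F = "{B. B \<subseteq> I \<and> {j} \<subseteq> B}"
  have fin: "finite ?F" using I by simp
  have w: "?w B \<ge> 0" if "B \<subseteq> I" for B using that p by (rule bernoulli_weight_nonneg)
  have pair: "(\<Sum>B\<in>?F. ?w B * of_bool (k \<in> B)) = p j * p k" if k: "k \<in> I - {j}" for k
  proof -
    have "(\<Sum>B\<in>?F. ?w B * of_bool (k \<in> B)) = (\<Sum>B | B \<subseteq> I \<and> {j, k} \<subseteq> B. ?w B)"
      using I by (intro sum.mono_neutral_cong_right) auto
    also have "\<dots> = p j * p k"
      using k j by (subst sum_bernoulli_weight_superset[OF I]) auto
    finally show ?thesis .
  qed
  have "(\<Sum>k\<in>I - {j}. p k) \<le> (\<Sum>k\<in>I. p k)" using p I by (intro sum_mono2) auto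
  with sum have sum': "(\<Sum>k\<in>I - {j}. p k) \<le> real s / 2" by simp
  have pj: "p j = (\<Sum>B\<in>?F. ?w B)"
    using sum_bernoulli_weight_superset[OF I, of "{j}" p] j by simp
  have "(\<Sum>k\<in>I - {j}. p j * p k) = (\<Sum>k\<in>I - {j}. \<Sum>B\<in>?F. ?w B * of_bool (k \<in> B))"
    by (intro sum.cong refl pair[symmetric])
  also have "\<dots> = (\<Sum>B\<in>?F. ?w B * (\<Sum>k\<in>I - {j}. of_bool (k \<in> B)))"
    by (subst sum.swap) (simp add: sum_distrib_left)
  finally have pairs: "(\<Sum>k\<in>I - {j}. p j * p k) = (\<Sum>B\<in>?F. ?w B * (\<Sum>k\<in>I - {j}. of_bool (k \<in> B)))" .
  have "p j / 2 \<le> p j - (\<Sum>k\<in>I - {j}. p j * p k) / s"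
  proof -
    have "p j * (\<Sum>k\<in>I - {j}. p k) \<le> p j * (real s / 2)"
      using sum' p j by (intro mult_left_mono) auto
    then have "(\<Sum>k\<in>I - {j}. p j * p k) \<le> p j / 2 * s" by (simp add: sum_distrib_left)
    then have "(\<Sum>k\<in>I - {j}. p j * p k) / s \<le> p j / 2" 
      using s by (simp add: divide_le_eq)
    then show ?thesis by linarith
  qed
  also have "\<dots> = (\<Sum>B\<in>?F. ?w B) - (\<Sum>B\<in>?F. ?w B * (\<Sum>k\<in>I - {j}. of_bool (k \<in> B))) / s"
    by (simp only: pairs) (simp only: pj)
  also have "\<dots> = (\<Sum>B\<in>?F. ?w B * (1 - (\<Sum>k\<in>I - {j}. of_bool (k \<in> B)) / s))"
    unfolding right_diff_distrib sum_subtractf sum_divide_distrib[of _ ?F] by simp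
  \<comment> \<open>A set that contains \<open>j\<close> and has more than \<open>s\<close> elements
    has at least \<open>s\<close> others, so the left factor is then nonpositive. Leaving
    \<open>j\<close> out of the count therefore loses nothing, and it keeps the expected count at
    most \<open>s / 2\<close>.\<close>
  also have "\<dots> \<le> (\<Sum>B\<in>?F. ?w B * of_bool (card B \<le> s))"
  proof (intro sum_mono mult_left_mono)
    fix B assume B: "B \<in> ?F"
    then have finB: "finite B" using I finite_subset by blast
    have "(\<Sum>k\<in>I - {j}. of_bool (k \<in> B) :: real) = (\<Sum>k\<in>B - {j}. 1)"
      using B I by (intro sum.mono_neutral_cong_right) auto
    also have "\<dots> = real (card B - 1)" using B finB by simp
    finally have c: "(\<Sum>k\<in>I - {j}. of_bool (k \<in> B) :: real) = real (card B - 1)" .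
    show "1 - (\<Sum>k\<in>I - {j}. of_bool (k \<in> B)) / real s \<le> of_bool (card B \<le> s)"
      unfolding c using s by (cases "card B \<le> s") (auto simp: field_simps)
  qed (use w in auto)
  also have "\<dots> = (\<Sum>B | B \<subseteq> I \<and> card B \<le> s \<and> j \<in> B. ?w B)"
    using I by (intro sum.mono_neutral_cong_right) auto
  finally show ?thesis .
qed

text \<open>The mixture over independent selections factorises over coordinates. Each ratio has mean
  1 under \<open>P\<close>, so a coordinate contributes at most
  \<open>1 - (p j)\<^sup>2 + (p j)\<^sup>2 * \<rho> j\<close>, which is below
  \<open>exp ((p j)\<^sup>2 * \<rho> j)\<close>.\<close>

lemma nn_integral_square_mixture_ratio_le:
  fixes f :: "real \<Rightarrow> real"
  defines "P \<equiv> density lborel (\<lambda>x. ennreal (f x))"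
  assumes I: "finite I" and [measurable]: "f \<in> borel_measurable borel" and f: "\<And>x. f x > 0"
    and P: "prob_space P" and p: "\<And>j. j \<in> I \<Longrightarrow> 0 \<le> p j \<and> p j \<le> 1"
    and \<rho>: "\<And>j. j \<in> I \<Longrightarrow> (\<integral>\<^sup>+x. ennreal ((f (x - \<delta> j))\<^sup>2 / f x) \<partial>lborel) \<le> ennreal (\<rho> j)"
    and \<rho>0: "\<And>j. j \<in> I \<Longrightarrow> \<rho> j \<ge> 0"
  shows "(\<integral>\<^sup>+x. ennreal ((\<Prod>j\<in>I. 1 - p j + p j * (f (x j - \<delta> j) / f (x j)))\<^sup>2) \<partial>PiM I (\<lambda>_. P))
    \<le> ennreal (exp (\<Sum>j\<in>I. (p j)\<^sup>2 * \<rho> j))"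
proof -
  interpret P: prob_space P by fact
  have [measurable_cong, simp]: "sets P = sets borel" by (simp add: P_def)
  interpret PP: product_sigma_finite "\<lambda>_. P"
    by (simp add: product_sigma_finite_def P.sigma_finite_measure_axioms)
  have f0: "f x \<ge> 0" "f x \<noteq> 0" for x using f[of x] by auto
  have mass: "(\<integral>\<^sup>+x. ennreal (f x) \<partial>lborel) = 1"
    using P.emeasure_space_1 by (simp add: P_def emeasure_density)
  have ratio_mass: "(\<integral>\<^sup>+x. ennreal (f (x - a) / f x) \<partial>P) = 1" for a
  proof -
    have "(\<integral>\<^sup>+x. ennreal (f (x - a) / f x) \<partial>P) = (\<integral>\<^sup>+x. ennreal (f (x - a)) \<partial>lborel)"
      using f0 by (simp add: P_def nn_integral_density flip: ennreal_mult)
    also have "\<dots> = (\<integral>\<^sup>+x. ennreal (f x) \<partial>lborel)"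
      using nn_integral_real_affine[of "\<lambda>x. ennreal (f x)" 1 "- a"] by simp
    finally show ?thesis by (simp add: mass)
  qed
  have ratio_sq: "(\<integral>\<^sup>+x. ennreal ((f (x - a) / f x)\<^sup>2) \<partial>P) = (\<integral>\<^sup>+x. ennreal ((f (x - a))\<^sup>2 / f x) \<partial>lborel)" for a
  proof -
    have "(\<integral>\<^sup>+x. ennreal ((f (x - a) / f x)\<^sup>2) \<partial>P) = (\<integral>\<^sup>+x. ennreal (f x * (f (x - a) / f x)\<^sup>2) \<partial>lborel)"
      using f0 by (simp add: P_def nn_integral_density flip: ennreal_mult)
    also have "\<dots> = (\<integral>\<^sup>+x. ennreal ((f (x - a))\<^sup>2 / f x) \<partial>lborel)"
      using f0 by (intro nn_integral_cong) (simp add: power2_eq_square)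
    finally show ?thesis .
  qed
  have one: "(\<integral>\<^sup>+x. ennreal ((1 - p j + p j * (f (x - \<delta> j) / f x))\<^sup>2) \<partial>P) \<le> ennreal (exp ((p j)\<^sup>2 * \<rho> j))"
    if j: "j \<in> I" for j
  proof -
    let ?g = "\<lambda>x. f (x - \<delta> j) / f x"
    have pj: "0 \<le> p j" "p j \<le> 1" using p[OF j] by auto
    have "(\<integral>\<^sup>+x. ennreal ((1 - p j + p j * ?g x)\<^sup>2) \<partial>P) =
      (\<integral>\<^sup>+x. ennreal ((1 - p j)\<^sup>2) + ennreal (2 * p j * (1 - p j)) * ennreal (?g x) + ennreal ((p j)\<^sup>2) * ennreal ((?g x)\<^sup>2) \<partial>P)"
    proof (rule nn_integral_cong)
      fix x
      have "(1 - p j + p j * u)\<^sup>2 = (1 - p j)\<^sup>2 + 2 * p j * (1 - p j) * u + (p j)\<^sup>2 * u\<^sup>2" for u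
        by (simp add: power2_eq_square algebra_simps)
      then have "ennreal ((1 - p j + p j * u)\<^sup>2) =
        ennreal ((1 - p j)\<^sup>2) + ennreal (2 * p j * (1 - p j)) * ennreal u + ennreal ((p j)\<^sup>2) * ennreal (u\<^sup>2)"
        if "u \<ge> 0" for u
        using pj that by (simp add: ennreal_mult[symmetric] ennreal_plus[symmetric] del: ennreal_plus)
      moreover have "?g x \<ge> 0" using f0 by simp
      ultimately show "ennreal ((1 - p j + p j * ?g x)\<^sup>2) =
        ennreal ((1 - p j)\<^sup>2) + ennreal (2 * p j * (1 - p j)) * ennreal (?g x) + ennreal ((p j)\<^sup>2) * ennreal ((?g x)\<^sup>2)"
        by blast
    qed
    also have "\<dots> = ennreal ((1 - p j)\<^sup>2) + ennreal (2 * p j * (1 - p j)) +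
        ennreal ((p j)\<^sup>2) * (\<integral>\<^sup>+x. ennreal ((f (x - \<delta> j))\<^sup>2 / f x) \<partial>lborel)"
      by (simp add: nn_integral_add nn_integral_cmult ratio_mass ratio_sq P.emeasure_space_1)
    also have "\<dots> \<le> ennreal ((1 - p j)\<^sup>2) + ennreal (2 * p j * (1 - p j)) + ennreal ((p j)\<^sup>2) * ennreal (\<rho> j)"
      by (intro add_mono mult_left_mono \<rho> j) auto
    also have "\<dots> = ennreal ((1 - p j)\<^sup>2 + 2 * p j * (1 - p j) + (p j)\<^sup>2 * \<rho> j)"
      using pj \<rho>0[OF j] by (simp add: ennreal_mult[symmetric] ennreal_plus[symmetric] del: ennreal_plus)
    also have "\<dots> \<le> ennreal (exp ((p j)\<^sup>2 * \<rho> j))"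
    proof (rule ennreal_leI)
      have "(1 - p j)\<^sup>2 + 2 * p j * (1 - p j) = 1 - (p j)\<^sup>2"
        by (simp add: power2_eq_square algebra_simps)
      then show "(1 - p j)\<^sup>2 + 2 * p j * (1 - p j) + (p j)\<^sup>2 * \<rho> j \<le> exp ((p j)\<^sup>2 * \<rho> j)"
        using exp_ge_add_one_self[of "(p j)\<^sup>2 * \<rho> j"] zero_le_power2[of "p j"] by linarith
    qed
    finally show ?thesis .
  qed
  have "(\<integral>\<^sup>+x. ennreal ((\<Prod>j\<in>I. 1 - p j + p j * (f (x j - \<delta> j) / f (x j)))\<^sup>2) \<partial>PiM I (\<lambda>_. P)) =
    (\<integral>\<^sup>+x. (\<Prod>j\<in>I. ennreal ((1 - p j + p j * (f (x j - \<delta> j) / f (x j)))\<^sup>2)) \<partial>PiM I (\<lambda>_. P))"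
    by (simp add: prod_ennreal prod_power_distrib)
  also have "\<dots> = (\<Prod>j\<in>I. \<integral>\<^sup>+x. ennreal ((1 - p j + p j * (f (x - \<delta> j) / f x))\<^sup>2) \<partial>P)"
    by (rule PP.product_nn_integral_prod[OF I]) auto
  also have "\<dots> \<le> (\<Prod>j\<in>I. ennreal (exp ((p j)\<^sup>2 * \<rho> j)))"
    by (intro prod_mono_ennreal one)
  also have "\<dots> = ennreal (exp (\<Sum>j\<in>I. (p j)\<^sup>2 * \<rho> j))"
    using I by (simp add: prod_ennreal exp_sum)
  finally show ?thesis .
qed

text \<open>
  The constrained risk inequality: integrate \<open>\<zeta>(B) \<le> \<bar>T - \<zeta>(B)\<bar> + \<bar>T\<bar>\<close> against the law shifted
  along \<open>B\<close>, sum over a Bernoulli prior on \<open>B\<close> truncated to \<open>card B \<le> s\<close>, and change measure in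
  the second term.
\<close>

lemma mixture_mean_le_risks:
  fixes f :: "real \<Rightarrow> real" and T :: "('i \<Rightarrow> real) \<Rightarrow> real" and \<zeta> p \<rho> \<delta> :: "'i \<Rightarrow> real"
  defines "P \<equiv> density lborel (\<lambda>x. ennreal (f x))"
  assumes I: "finite I" and [measurable]: "f \<in> borel_measurable borel" and f: "\<And>x. f x > 0"
    and P: "prob_space P" and p: "\<And>j. j \<in> I \<Longrightarrow> 0 \<le> p j \<and> p j \<le> 1"
    and \<rho>: "\<And>j. j \<in> I \<Longrightarrow> (\<integral>\<^sup>+x. ennreal ((f (x - \<delta> j))\<^sup>2 / f x) \<partial>lborel) \<le> ennreal (\<rho> j)"
    and \<rho>0: "\<And>j. j \<in> I \<Longrightarrow> \<rho> j \<ge> 0"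
    and T[measurable]: "T \<in> borel_measurable (PiM I (\<lambda>_. borel))"
    and \<zeta>: "\<And>j. j \<in> I \<Longrightarrow> \<zeta> j \<ge> 0"
    and sum: "(\<Sum>j\<in>I. p j) \<le> real s / 2" and s: "s \<ge> 1"
    and R1: "\<And>B. B \<subseteq> I \<Longrightarrow> card B \<le> s \<Longrightarrow>
      (\<integral>\<^sup>+x. ennreal ((T (\<lambda>j\<in>I. (if j \<in> B then \<delta> j else 0) + x j) - (\<Sum>j\<in>B. \<zeta> j))\<^sup>2) \<partial>PiM I (\<lambda>_. P)) \<le> ennreal R1"
    and R0: "(\<integral>\<^sup>+x. ennreal ((T x)\<^sup>2) \<partial>PiM I (\<lambda>_. P)) \<le> ennreal R0"
    and R_nonneg: "R0 \<ge> 0" "R1 \<ge> 0" and ab: "a > 0" "b > 0"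
  shows "(\<Sum>j\<in>I. p j * \<zeta> j) / 2 \<le>
    a / 2 + R1 / (2 * a) + b / 2 * exp (\<Sum>j\<in>I. (p j)\<^sup>2 * \<rho> j) + R0 / (2 * b)"
proof -
  interpret P: prob_space P by fact
  have [measurable_cong, simp]: "sets P = sets borel" by (simp add: P_def)
  have setsPM[measurable_cong, simp]: "sets (PiM I (\<lambda>_. P)) = sets (PiM I (\<lambda>_. borel))"
    by (intro sets_PiM_cong) auto
  interpret PP: prob_space "PiM I (\<lambda>_. P)" by (intro prob_space_PiM P)
  let ?PM = "PiM I (\<lambda>_. P)" and ?w = "bernoulli_weight I p"
  let ?S = "{B. B \<subseteq> I \<and> card B \<le> s}"
  have finS: "finite ?S" using I by simp
  have w: "?w B \<ge> 0" if "B \<subseteq> I" for B using that p by (rule bernoulli_weight_nonneg)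
  have f0: "f x \<ge> 0" "f x \<noteq> 0" for x using f[of x] by auto
  define g where "g j x = f (x j - \<delta> j) / f (x j)" for j and x :: "'i \<Rightarrow> real"
  have g0: "g j x \<ge> 0" for j x using f0 by (simp add: g_def)
  have g_meas[measurable]: "(\<lambda>x. g j x) \<in> borel_measurable (PiM I (\<lambda>_. borel))" if "j \<in> I" for j
    unfolding g_def using that by measurable
  define G where "G B x = (\<Prod>j\<in>B. g j x)" for B x
  have G0: "G B x \<ge> 0" for B x by (simp add: G_def prod_nonneg g0)
  have G_meas[measurable]: "G B \<in> borel_measurable (PiM I (\<lambda>_. borel))" if "B \<subseteq> I" for B
    unfolding G_def using that by (intro borel_measurable_prod g_meas) auto
  have shift: "(\<integral>\<^sup>+x. ennreal \<bar>T (\<lambda>j\<in>I. (if j \<in> B then \<delta> j else 0) + x j)\<bar> \<partial>?PM) =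
      (\<integral>\<^sup>+x. ennreal (G B x * \<bar>T x\<bar>) \<partial>?PM)" if B: "B \<subseteq> I" for B
  proof -
    have "(\<integral>\<^sup>+x. ennreal \<bar>T (\<lambda>j\<in>I. (if j \<in> B then \<delta> j else 0) + x j)\<bar> \<partial>?PM) =
      (\<integral>\<^sup>+x. (\<Prod>j\<in>I. ennreal (f (x j - (if j \<in> B then \<delta> j else 0)) / f (x j))) * ennreal \<bar>T x\<bar> \<partial>?PM)"
      unfolding P_def by (rule nn_integral_PiM_shift) (use I f P in \<open>auto simp: P_def\<close>)
    also have "\<dots> = (\<integral>\<^sup>+x. ennreal (G B x * \<bar>T x\<bar>) \<partial>?PM)"
    proof (rule nn_integral_cong)
      fix x
      have "(\<Prod>j\<in>I. ennreal (f (x j - (if j \<in> B then \<delta> j else 0)) / f (x j))) = (\<Prod>j\<in>B. ennreal (g j x))"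
        using I B f0 by (intro prod.mono_neutral_cong_right) (auto simp: g_def)
      also have "\<dots> = ennreal (G B x)" using g0 by (simp add: G_def prod_ennreal)
      finally show "(\<Prod>j\<in>I. ennreal (f (x j - (if j \<in> B then \<delta> j else 0)) / f (x j))) * ennreal \<bar>T x\<bar> =
          ennreal (G B x * \<bar>T x\<bar>)"
        using G0 by (simp add: ennreal_mult)
    qed
    finally show ?thesis .
  qed
  \<comment> \<open>By the arithmetic-geometric mean inequality with parameter \<open>a\<close>,
    \<open>c\<close> bounds the mean of the distance from the estimator to the shifted value, for
    every admissible \<open>B\<close>.\<close>
  define c where "c = a / 2 + R1 / (2 * a)"
  have c0: "c \<ge> 0" using ab R_nonneg by (simp add: c_def)
  have amgm: "\<bar>u\<bar> * v \<le> z / 2 * v\<^sup>2 + u\<^sup>2 / (2 * z)" if "z > 0" for u v z :: real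
  proof -
    have "0 \<le> (z * v - \<bar>u\<bar>)\<^sup>2" by simp
    then have "2 * z * (\<bar>u\<bar> * v) \<le> z\<^sup>2 * v\<^sup>2 + u\<^sup>2"
      by (simp add: power2_eq_square algebra_simps)
    then have "2 * z * (\<bar>u\<bar> * v) / (2 * z) \<le> (z\<^sup>2 * v\<^sup>2 + u\<^sup>2) / (2 * z)"
      using that by (intro divide_right_mono) auto
    then show ?thesis using that by (simp add: add_divide_distrib power2_eq_square)
  qed
  have perB: "ennreal (\<Sum>j\<in>B. \<zeta> j) \<le> ennreal c + (\<integral>\<^sup>+x. ennreal (G B x * \<bar>T x\<bar>) \<partial>?PM)"
    if B: "B \<in> ?S" for B
  proof -
    let ?T = "\<lambda>x. T (\<lambda>j\<in>I. (if j \<in> B then \<delta> j else 0) + x j)" and ?l = "\<Sum>j\<in>B. \<zeta> j"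
    have [measurable]: "?T \<in> borel_measurable (PiM I (\<lambda>_. borel))" by measurable
    have "ennreal ?l = (\<integral>\<^sup>+x. ennreal ?l \<partial>?PM)" by (simp add: PP.emeasure_space_1)
    also have "\<dots> \<le> (\<integral>\<^sup>+x. ennreal (a / 2) + ennreal (1 / (2 * a)) * ennreal ((?T x - ?l)\<^sup>2) + ennreal \<bar>?T x\<bar> \<partial>?PM)"
    proof (rule nn_integral_mono)
      fix x
      have "u \<le> \<bar>t - u\<bar> * 1 + \<bar>t\<bar>" for t u :: real by auto
      then have "?l \<le> \<bar>?T x - ?l\<bar> * 1 + \<bar>?T x\<bar>" .
      also have "\<dots> \<le> a / 2 + 1 / (2 * a) * (?T x - ?l)\<^sup>2 + \<bar>?T x\<bar>"
        using amgm[OF ab(1), of "?T x - ?l" 1] by simp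
      finally have "ennreal ?l \<le> ennreal (a / 2 + 1 / (2 * a) * (?T x - ?l)\<^sup>2 + \<bar>?T x\<bar>)"
        by (rule ennreal_leI)
      also have "\<dots> = ennreal (a / 2) + ennreal (1 / (2 * a)) * ennreal ((?T x - ?l)\<^sup>2) + ennreal \<bar>?T x\<bar>"
        using ab by (simp add: ennreal_mult[symmetric] ennreal_plus[symmetric] del: ennreal_plus)
      finally show "ennreal ?l \<le> ennreal (a / 2) + ennreal (1 / (2 * a)) * ennreal ((?T x - ?l)\<^sup>2) + ennreal \<bar>?T x\<bar>" .
    qed
    also have "\<dots> = ennreal (a / 2) + ennreal (1 / (2 * a)) * (\<integral>\<^sup>+x. ennreal ((?T x - ?l)\<^sup>2) \<partial>?PM) +
        (\<integral>\<^sup>+x. ennreal (G B x * \<bar>T x\<bar>) \<partial>?PM)"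
      using B by (simp add: nn_integral_add nn_integral_cmult PP.emeasure_space_1 shift)
    also have "\<dots> \<le> ennreal (a / 2) + ennreal (1 / (2 * a)) * ennreal R1 +
        (\<integral>\<^sup>+x. ennreal (G B x * \<bar>T x\<bar>) \<partial>?PM)"
      using B by (intro add_mono mult_left_mono R1) auto
    also have "ennreal (a / 2) + ennreal (1 / (2 * a)) * ennreal R1 = ennreal c"
      using ab R_nonneg unfolding c_def
      by (simp add: ennreal_mult[symmetric] ennreal_plus[symmetric] del: ennreal_plus)
    finally show ?thesis .
  qed
  \<comment> \<open>\<open>M\<close> is the likelihood ratio of the mixture without truncation. It
    is a product over coordinates, which the truncated mixture is not, and it dominates the
    truncated one because all omitted terms are nonnegative.\<close>
  define M where "M x = (\<Prod>j\<in>I. 1 - p j + p j * g j x)" for x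
  have M_meas[measurable]: "M \<in> borel_measurable (PiM I (\<lambda>_. borel))" unfolding M_def by measurable
  have mix: "(\<Sum>B\<in>?S. ?w B * G B x) \<le> M x" for x
  proof -
    have "(\<Sum>B\<in>?S. ?w B * G B x) \<le> (\<Sum>B\<in>Pow I. ?w B * G B x)"
      using I w G0 by (intro sum_mono2) auto
    also have "\<dots> = (\<Sum>B\<in>Pow I. (\<Prod>j\<in>B. p j * g j x) * (\<Prod>j\<in>I - B. 1 - p j))"
      by (intro sum.cong) (auto simp: bernoulli_weight_def G_def prod.distrib)
    also have "\<dots> = (\<Prod>j\<in>I. p j * g j x + (1 - p j))" by (rule prod_add[OF I, symmetric])
    also have "\<dots> = M x" by (simp add: M_def add.commute)
    finally show ?thesis .
  qed
  let ?E = "exp (\<Sum>j\<in>I. (p j)\<^sup>2 * \<rho> j)"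
  have M2: "(\<integral>\<^sup>+x. ennreal ((M x)\<^sup>2) \<partial>?PM) \<le> ennreal ?E"
    unfolding M_def g_def P_def
    by (rule nn_integral_square_mixture_ratio_le) (use I f P p \<rho> \<rho>0 in \<open>auto simp: P_def\<close>)
  have w_le_1: "(\<Sum>B\<in>?S. ?w B) \<le> 1"
  proof -
    have "(\<Sum>B\<in>?S. ?w B) \<le> (\<Sum>B | B \<subseteq> I \<and> {} \<subseteq> B. ?w B)"
      using I w by (intro sum_mono2) auto
    also have "\<dots> = 1" by (subst sum_bernoulli_weight_superset[OF I]) auto
    finally show ?thesis .
  qed
  have "ennreal (\<Sum>B\<in>?S. ?w B * (\<Sum>j\<in>B. \<zeta> j)) = (\<Sum>B\<in>?S. ennreal (?w B) * ennreal (\<Sum>j\<in>B. \<zeta> j))"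
  proof (subst sum_ennreal[symmetric])
    fix B assume "B \<in> ?S"
    then show "0 \<le> ?w B * (\<Sum>j\<in>B. \<zeta> j)" using w \<zeta> by (auto intro!: mult_nonneg_nonneg sum_nonneg)
  next
    show "(\<Sum>B\<in>?S. ennreal (?w B * (\<Sum>j\<in>B. \<zeta> j))) = (\<Sum>B\<in>?S. ennreal (?w B) * ennreal (\<Sum>j\<in>B. \<zeta> j))"
      using w \<zeta> by (intro sum.cong refl ennreal_mult) (auto intro!: sum_nonneg)
  qed
  also have "\<dots> \<le> (\<Sum>B\<in>?S. ennreal (?w B) * (ennreal c + (\<integral>\<^sup>+x. ennreal (G B x * \<bar>T x\<bar>) \<partial>?PM)))"
    by (intro sum_mono mult_left_mono perB) auto
  also have "\<dots> = (\<Sum>B\<in>?S. ennreal (?w B)) * ennreal c +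
      (\<Sum>B\<in>?S. ennreal (?w B) * (\<integral>\<^sup>+x. ennreal (G B x * \<bar>T x\<bar>) \<partial>?PM))"
    by (simp add: distrib_left sum.distrib sum_distrib_right)
  finally have *: "ennreal (\<Sum>B\<in>?S. ?w B * (\<Sum>j\<in>B. \<zeta> j)) \<le> (\<Sum>B\<in>?S. ennreal (?w B)) * ennreal c +
      (\<Sum>B\<in>?S. ennreal (?w B) * (\<integral>\<^sup>+x. ennreal (G B x * \<bar>T x\<bar>) \<partial>?PM))" .
  have "(\<Sum>B\<in>?S. ennreal (?w B) * (\<integral>\<^sup>+x. ennreal (G B x * \<bar>T x\<bar>) \<partial>?PM)) =
      (\<integral>\<^sup>+x. (\<Sum>B\<in>?S. ennreal (?w B) * ennreal (G B x * \<bar>T x\<bar>)) \<partial>?PM)"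
    by (subst nn_integral_sum) (auto intro!: sum.cong simp: nn_integral_cmult)
  also have "\<dots> \<le> (\<integral>\<^sup>+x. ennreal (b / 2) * ennreal ((M x)\<^sup>2) + ennreal (1 / (2 * b)) * ennreal ((T x)\<^sup>2) \<partial>?PM)"
  proof (rule nn_integral_mono)
    fix x
    have "(\<Sum>B\<in>?S. ennreal (?w B) * ennreal (G B x * \<bar>T x\<bar>)) = (\<Sum>B\<in>?S. ennreal (?w B * G B x * \<bar>T x\<bar>))"
      using w G0 by (intro sum.cong refl) (simp add: mult.assoc ennreal_mult)
    also have "\<dots> = ennreal (\<Sum>B\<in>?S. ?w B * G B x * \<bar>T x\<bar>)"
      using w G0 by (intro sum_ennreal) auto
    also have "\<dots> \<le> ennreal (b / 2 * (M x)\<^sup>2 + 1 / (2 * b) * (T x)\<^sup>2)"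
    proof (rule ennreal_leI)
      have "(\<Sum>B\<in>?S. ?w B * G B x * \<bar>T x\<bar>) = \<bar>T x\<bar> * (\<Sum>B\<in>?S. ?w B * G B x)"
        by (simp add: sum_distrib_left mult_ac)
      also have "\<dots> \<le> \<bar>T x\<bar> * M x" using mix by (intro mult_left_mono) auto
      also have "\<dots> \<le> b / 2 * (M x)\<^sup>2 + 1 / (2 * b) * (T x)\<^sup>2"
        using amgm[OF ab(2), of "T x" "M x"] by simp
      finally show "(\<Sum>B\<in>?S. ?w B * G B x * \<bar>T x\<bar>) \<le> b / 2 * (M x)\<^sup>2 + 1 / (2 * b) * (T x)\<^sup>2" .
    qed
    also have "\<dots> = ennreal (b / 2) * ennreal ((M x)\<^sup>2) + ennreal (1 / (2 * b)) * ennreal ((T x)\<^sup>2)"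
      using ab by (simp add: ennreal_mult[symmetric] ennreal_plus[symmetric] del: ennreal_plus)
    finally show "(\<Sum>B\<in>?S. ennreal (?w B) * ennreal (G B x * \<bar>T x\<bar>)) \<le>
        ennreal (b / 2) * ennreal ((M x)\<^sup>2) + ennreal (1 / (2 * b)) * ennreal ((T x)\<^sup>2)" .
  qed
  also have "\<dots> = ennreal (b / 2) * (\<integral>\<^sup>+x. ennreal ((M x)\<^sup>2) \<partial>?PM) +
      ennreal (1 / (2 * b)) * (\<integral>\<^sup>+x. ennreal ((T x)\<^sup>2) \<partial>?PM)"
    by (simp add: nn_integral_add nn_integral_cmult)
  also have "\<dots> \<le> ennreal (b / 2) * ennreal ?E + ennreal (1 / (2 * b)) * ennreal R0"
    by (intro add_mono mult_left_mono M2 R0) auto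
  finally have **: "(\<Sum>B\<in>?S. ennreal (?w B) * (\<integral>\<^sup>+x. ennreal (G B x * \<bar>T x\<bar>) \<partial>?PM)) \<le>
      ennreal (b / 2) * ennreal ?E + ennreal (1 / (2 * b)) * ennreal R0" .
  have "(\<Sum>B\<in>?S. ennreal (?w B)) * ennreal c \<le> ennreal 1 * ennreal c"
  proof (rule mult_right_mono)
    have "(\<Sum>B\<in>?S. ennreal (?w B)) = ennreal (\<Sum>B\<in>?S. ?w B)" using w by (intro sum_ennreal) auto
    also have "\<dots> \<le> ennreal 1" using w_le_1 by (rule ennreal_leI)
    finally show "(\<Sum>B\<in>?S. ennreal (?w B)) \<le> ennreal 1" .
  qed simp
  with * ** have "ennreal (\<Sum>B\<in>?S. ?w B * (\<Sum>j\<in>B. \<zeta> j)) \<le>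
      ennreal 1 * ennreal c + (ennreal (b / 2) * ennreal ?E + ennreal (1 / (2 * b)) * ennreal R0)"
    by (blast intro: order_trans add_mono)
  also have "ennreal 1 * ennreal c + (ennreal (b / 2) * ennreal ?E + ennreal (1 / (2 * b)) * ennreal R0) =
      ennreal (c + (b / 2 * ?E + 1 / (2 * b) * R0))"
    using ab R_nonneg c0 by (simp add: ennreal_mult[symmetric] ennreal_plus[symmetric] del: ennreal_plus)
  finally have bound: "(\<Sum>B\<in>?S. ?w B * (\<Sum>j\<in>B. \<zeta> j)) \<le> c + (b / 2 * ?E + 1 / (2 * b) * R0)"
    using ab R_nonneg c0 by (subst (asm) ennreal_le_iff) auto
  \<comment> \<open>The factor 1/2 is the price of truncation: each truncated marginal retains at
    least half of \<open>p j\<close>, and exchanging the sums turns these marginals into the mean of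
    the shifted value.\<close>
  have "(\<Sum>j\<in>I. p j * \<zeta> j) / 2 = (\<Sum>j\<in>I. p j / 2 * \<zeta> j)" by (simp add: sum_divide_distrib)
  also have "\<dots> \<le> (\<Sum>j\<in>I. (\<Sum>B | B \<subseteq> I \<and> card B \<le> s \<and> j \<in> B. ?w B) * \<zeta> j)"
    using bernoulli_weight_truncated_marginal[OF I p sum s] \<zeta>
    by (intro sum_mono mult_right_mono) auto
  also have "\<dots> = (\<Sum>j\<in>I. \<Sum>B\<in>?S. ?w B * (of_bool (j \<in> B) * \<zeta> j))"
  proof (rule sum.cong)
    fix j
    have "(\<Sum>B | B \<subseteq> I \<and> card B \<le> s \<and> j \<in> B. ?w B) * \<zeta> j = (\<Sum>B | B \<subseteq> I \<and> card B \<le> s \<and> j \<in> B. ?w B * \<zeta> j)"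
      by (rule sum_distrib_right)
    also have "\<dots> = (\<Sum>B\<in>?S. ?w B * (of_bool (j \<in> B) * \<zeta> j))"
      using finS by (intro sum.mono_neutral_cong_left) auto
    finally show "(\<Sum>B | B \<subseteq> I \<and> card B \<le> s \<and> j \<in> B. ?w B) * \<zeta> j = (\<Sum>B\<in>?S. ?w B * (of_bool (j \<in> B) * \<zeta> j))" .
  qed simp
  also have "\<dots> = (\<Sum>B\<in>?S. ?w B * (\<Sum>j\<in>I. of_bool (j \<in> B) * \<zeta> j))"
    by (subst sum.swap) (simp add: sum_distrib_left)
  also have "\<dots> = (\<Sum>B\<in>?S. ?w B * (\<Sum>j\<in>B. \<zeta> j))"
  proof (rule sum.cong)
    fix B assume "B \<in> ?S"
    then have "(\<Sum>j\<in>I. of_bool (j \<in> B) * \<zeta> j) = (\<Sum>j\<in>B. \<zeta> j)"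
      using I by (intro sum.mono_neutral_cong_right) auto
    then show "?w B * (\<Sum>j\<in>I. of_bool (j \<in> B) * \<zeta> j) = ?w B * (\<Sum>j\<in>B. \<zeta> j)" by simp
  qed simp
  also note bound
  finally show ?thesis by (simp add: c_def)
qed

section \<open>Sparse priors\<close>

text \<open>
  \<open>p j\<close> is the multiple \<open>k * sqrt (L / V) * \<bar>\<eta> j\<bar> * e j\<close>, set to \<open>0\<close> where that exceeds \<open>1\<close>. The
  removed indices carry a total of at most \<open>k\<^sup>2 * L\<close>, and one of them alone
  dominates \<open>V\<close>.
\<close>

lemma exists_thinned_weights:
  fixes \<eta> e :: "'i \<Rightarrow> real"
  assumes I: "finite I" and e: "\<And>j. j \<in> I \<Longrightarrow> 0 < e j \<and> e j \<le> 1"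
    and V: "V = (\<Sum>j\<in>I. (\<eta> j)\<^sup>2 * e j)" "V > 0"
    and k: "0 < k" "k \<le> 1/4" and L: "1 \<le> L" "L \<le> r"
    and le: "(\<Sum>j\<in>I. \<bar>\<eta> j\<bar> * e j) \<le> r / (2 * sqrt L) * sqrt V"
  obtains p where "\<And>j. j \<in> I \<Longrightarrow> 0 \<le> p j \<and> p j \<le> 1" "(\<Sum>j\<in>I. p j) \<le> r / 2"
    "(\<Sum>j\<in>I. (p j)\<^sup>2 / e j) \<le> k\<^sup>2 * L"
    "(\<Sum>j\<in>I. \<bar>\<eta> j\<bar> * e j) = r / (2 * sqrt L) * sqrt V \<Longrightarrow> k * r / 4 \<le> (\<Sum>j\<in>I. p j)"
    "(\<Sum>j\<in>I. p j * \<bar>\<eta> j\<bar>) = k * sqrt (L * V) \<or> (\<exists>j\<in>I. V \<le> k\<^sup>2 * L * (\<eta> j)\<^sup>2 \<and> 1 < k\<^sup>2 * L)"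
proof -
  define q where "q j = k * sqrt L * (\<bar>\<eta> j\<bar> * e j) / sqrt V" for j
  define p where "p j = (if q j \<le> 1 then q j else 0)" for j
  have sV: "sqrt V > 0" and sL: "sqrt L > 0" and r: "r > 0" using V L by auto
  have q0: "q j \<ge> 0" if "j \<in> I" for j using that e[of j] k L V(2) by (auto simp: q_def)
  have q2: "(q j)\<^sup>2 = k\<^sup>2 * L * ((\<eta> j)\<^sup>2 * e j) / V * e j" if "j \<in> I" for j
    using V(2) L by (simp add: q_def power_divide power_mult_distrib power2_eq_square[of "e j"])
  have q2e: "(q j)\<^sup>2 / e j = k\<^sup>2 * L * ((\<eta> j)\<^sup>2 * e j) / V" if "j \<in> I" for j
    using q2[OF that] e[OF that] by simp
  have sum_q2e: "(\<Sum>j\<in>I. (q j)\<^sup>2 / e j) = k\<^sup>2 * L"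
  proof -
    have "(\<Sum>j\<in>I. (q j)\<^sup>2 / e j) = (\<Sum>j\<in>I. k\<^sup>2 * L / V * ((\<eta> j)\<^sup>2 * e j))"
      by (intro sum.cong) (auto simp: q2e)
    also have "\<dots> = k\<^sup>2 * L / V * V" unfolding V(1) by (simp only: sum_distrib_left)
    finally show ?thesis using V(2) by simp
  qed
  have sum_q: "(\<Sum>j\<in>I. q j) = k * sqrt L / sqrt V * (\<Sum>j\<in>I. \<bar>\<eta> j\<bar> * e j)"
    by (simp add: q_def sum_distrib_left)
  have pq: "p j \<le> q j" if "j \<in> I" for j using q0[OF that] by (simp add: p_def)
  show ?thesis
  proof (rule that[of p])
    show "0 \<le> p j \<and> p j \<le> 1" if "j \<in> I" for j using q0[OF that] by (simp add: p_def)
    have "(\<Sum>j\<in>I. p j) \<le> (\<Sum>j\<in>I. q j)" by (intro sum_mono pq)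
    also have "\<dots> \<le> k * sqrt L / sqrt V * (r / (2 * sqrt L) * sqrt V)"
      unfolding sum_q using k L V(2) by (intro mult_left_mono le) auto
    also have "\<dots> = k * r / 2" using sL sV by simp
    also have "\<dots> \<le> r / 2" using k r by simp
    finally show "(\<Sum>j\<in>I. p j) \<le> r / 2" .
    have "(p j)\<^sup>2 / e j \<le> (q j)\<^sup>2 / e j" if "j \<in> I" for j
      using e[OF that] by (auto simp: p_def)
    then have "(\<Sum>j\<in>I. (p j)\<^sup>2 / e j) \<le> (\<Sum>j\<in>I. (q j)\<^sup>2 / e j)" by (rule sum_mono)
    then show "(\<Sum>j\<in>I. (p j)\<^sup>2 / e j) \<le> k\<^sup>2 * L" by (simp add: sum_q2e)
    \<comment> \<open>A removed \<open>q j\<close> exceeds 1, hence is at most its square; so the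
      total removed is bounded by the same sum that controls the second moment.\<close>
    have "(\<Sum>j\<in>I. q j - p j) \<le> (\<Sum>j\<in>I. (q j)\<^sup>2 / e j)"
    proof (rule sum_mono)
      fix j assume j: "j \<in> I"
      have "q j - p j \<le> (q j)\<^sup>2" using q0[OF j] by (auto simp: p_def power2_eq_square)
      also have "\<dots> \<le> (q j)\<^sup>2 / e j" using e[OF j] by (simp add: le_divide_eq mult_left_le)
      finally show "q j - p j \<le> (q j)\<^sup>2 / e j" .
    qed
    then have lost: "(\<Sum>j\<in>I. q j) - k\<^sup>2 * L \<le> (\<Sum>j\<in>I. p j)" by (simp add: sum_subtractf sum_q2e)
    show "k * r / 4 \<le> (\<Sum>j\<in>I. p j)" if eq: "(\<Sum>j\<in>I. \<bar>\<eta> j\<bar> * e j) = r / (2 * sqrt L) * sqrt V"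
    proof -
      have "(\<Sum>j\<in>I. q j) = k * r / 2" unfolding sum_q eq using sL sV by simp
      \<comment> \<open>With \<open>k \<le> 1/4\<close> and \<open>L \<le> r\<close>, thinning
        removes at most half of the total \<open>k * r / 2\<close>.\<close>
      moreover have "k * (k * L) \<le> k * (1/4 * r)" using k L by (intro mult_left_mono mult_mono) auto
      ultimately show ?thesis using lost by (simp add: power2_eq_square)
    qed
    show "(\<Sum>j\<in>I. p j * \<bar>\<eta> j\<bar>) = k * sqrt (L * V) \<or> (\<exists>j\<in>I. V \<le> k\<^sup>2 * L * (\<eta> j)\<^sup>2 \<and> 1 < k\<^sup>2 * L)"
    proof (cases "\<forall>j\<in>I. q j \<le> 1")
      case True
      then have "(\<Sum>j\<in>I. p j * \<bar>\<eta> j\<bar>) = (\<Sum>j\<in>I. k * sqrt L / sqrt V * ((\<eta> j)\<^sup>2 * e j))"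
      proof (intro sum.cong refl)
        fix j assume "j \<in> I"
        with True have "p j * \<bar>\<eta> j\<bar> = k * sqrt L / sqrt V * (\<bar>\<eta> j\<bar> * \<bar>\<eta> j\<bar> * e j)"
          by (simp add: p_def q_def)
        then show "p j * \<bar>\<eta> j\<bar> = k * sqrt L / sqrt V * ((\<eta> j)\<^sup>2 * e j)"
          by (simp add: power2_eq_square)
      qed
      also have "\<dots> = k * sqrt L / sqrt V * V" unfolding V(1) by (simp only: sum_distrib_left)
      also have "\<dots> = k * sqrt L * (V / sqrt V)" by simp
      also have "\<dots> = k * sqrt (L * V)" using V(2) by (simp add: real_div_sqrt real_sqrt_mult)
      finally show ?thesis ..
    next
      case False
      then obtain j where j: "j \<in> I" "q j > 1" by auto
      have "1 < (q j)\<^sup>2" using j by (simp add: one_less_power)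
      then have V1: "V < k\<^sup>2 * L * (\<eta> j)\<^sup>2 * (e j * e j)"
        using V(2) by (simp add: q2[OF j(1)] less_divide_eq mult_ac)
      also have "\<dots> \<le> k\<^sup>2 * L * (\<eta> j)\<^sup>2 * 1"
        using e[OF j(1)] L by (intro mult_left_mono mult_le_one) auto
      finally have 1: "V < k\<^sup>2 * L * (\<eta> j)\<^sup>2" by simp
      \<comment> \<open>Combining the single-term bound with
        \<open>V < k\<^sup>2 * L * (\<eta> j)\<^sup>2 * (e j)\<^sup>2\<close> and cancelling
        \<open>V\<close> yields \<open>1 < k\<^sup>2 * L * e j\<close>. So an index can be removed
        only when \<open>L\<close> is large.\<close>
      have "(\<eta> j)\<^sup>2 * e j \<le> V" unfolding V(1)
      proof (rule member_le_sum[OF j(1) _ I])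
        fix i assume "i \<in> I - {j}"
        then show "0 \<le> (\<eta> i)\<^sup>2 * e i" using e[of i] by simp
      qed
      then have "k\<^sup>2 * L * e j * ((\<eta> j)\<^sup>2 * e j) \<le> k\<^sup>2 * L * e j * V"
        using e[OF j(1)] L by (intro mult_left_mono) auto
      with V1 have "V * 1 < V * (k\<^sup>2 * L * e j)" by (simp add: mult_ac)
      then have "1 < k\<^sup>2 * L * e j" using V(2) by (simp only: mult_less_cancel_left_pos)
      also have "\<dots> \<le> k\<^sup>2 * L * 1" using e[OF j(1)] L by (intro mult_left_mono) auto
      finally show ?thesis using 1 j(1) by (auto intro: less_imp_le)
    qed
  qed
qed

text \<open>The constrained risk inequality in the model, with \<open>D\<close> below half the prior
  mean of the linear functional. An estimator whose risk on the sparse class is a small fraction of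
  \<open>D\<^sup>2\<close> must follow the mixture; the likelihood ratio bound \<open>M\<close> then
  limits how small its risk at the origin can be.\<close>

lemma sparse_prior_risk:
  fixes f :: "real \<Rightarrow> real" and \<eta> p \<rho> :: "nat \<Rightarrow> real"
  defines "P \<equiv> density lborel (\<lambda>x. ennreal (f x))"
  assumes f_meas: "f \<in> borel_measurable borel" and f: "\<And>x. f x > 0"
    and noise: "P \<in> noise_class \<alpha> \<tau>"
    and \<rho>: "\<And>j \<delta>. j \<in> {1..d} \<Longrightarrow> \<bar>\<delta>\<bar> = c * (1 + l / \<bar>\<eta> j\<bar>) \<Longrightarrow>
      (\<integral>\<^sup>+x. ennreal ((f (x - \<delta>))\<^sup>2 / f x) \<partial>lborel) \<le> ennreal (\<rho> j)"
    and \<rho>0: "\<And>j. j \<in> {1..d} \<Longrightarrow> \<rho> j \<ge> 0"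
    and \<eta>: "\<And>j. j \<in> {1..d} \<Longrightarrow> \<bar>\<eta> j\<bar> > 0" and pos: "\<sigma> > 0" "c > 0" "l \<ge> 0"
    and T: "T \<in> estimators d" and r: "r \<ge> 1"
    and p: "\<And>j. j \<in> {1..d} \<Longrightarrow> 0 \<le> p j \<and> p j \<le> 1" "(\<Sum>j\<in>{1..d}. p j) \<le> real r / 2"
    and R1: "max_risk d \<eta> \<sigma> \<alpha> \<tau> T r \<le> ennreal R1" and R0: "max_risk d \<eta> \<sigma> \<alpha> \<tau> T 1 \<le> ennreal R0"
    and R: "R0 \<ge> 0" "R1 \<ge> 0"
    and M: "exp (\<Sum>j\<in>{1..d}. (p j)\<^sup>2 * \<rho> j) \<le> M"
    and D: "0 < D" "D \<le> \<sigma> * c * (\<Sum>j\<in>{1..d}. p j * (\<bar>\<eta> j\<bar> + l)) / 2" "R1 \<le> D\<^sup>2 / 16"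
  shows "D\<^sup>2 \<le> 2 * M * R0"
proof -
  note One_nat_def [simp del]
  let ?I = "{1..d}"
  have [measurable_cong, simp]: "sets P = sets borel" by (simp add: P_def)
  have setsPM[measurable_cong]: "sets (PiM ?I (\<lambda>_. P)) = sets (PiM ?I (\<lambda>_. borel))"
    by (intro sets_PiM_cong) auto
  have T_meas[measurable]: "T \<in> borel_measurable (PiM ?I (\<lambda>_. borel))"
    using T by (simp add: estimators_def)
  have PQ: "PiM ?I (\<lambda>_. P) \<in> noise_prod_class d \<alpha> \<tau>" using noise by (auto simp: noise_prod_class_def)
  \<comment> \<open>The sign of \<open>\<eta> j\<close> aligns all shifts, so each selected
    coordinate raises the functional by the positive amount \<open>\<zeta> j\<close>.\<close>
  define \<delta> where "\<delta> j = sgn (\<eta> j) * c * (1 + l / \<bar>\<eta> j\<bar>)" for j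
  define \<zeta> where "\<zeta> j = \<sigma> * c * (\<bar>\<eta> j\<bar> + l)" for j
  \<comment> \<open>Working with the rescaled estimator reduces the noise level to 1.\<close>
  define T' where "T' x = T (\<lambda>j\<in>?I. \<sigma> * x j)" for x
  have T'_meas: "T' \<in> borel_measurable (PiM ?I (\<lambda>_. borel))" unfolding T'_def by measurable
  have abs_\<delta>: "\<bar>\<delta> j\<bar> = c * (1 + l / \<bar>\<eta> j\<bar>)" if "j \<in> ?I" for j
    using \<eta>[OF that] pos by (simp add: \<delta>_def abs_mult abs_sgn_eq)
  have \<eta>\<delta>: "\<eta> j * (\<sigma> * \<delta> j) = \<zeta> j" if "j \<in> ?I" for j
  proof -
    have "\<eta> j * sgn (\<eta> j) = \<bar>\<eta> j\<bar>" by (simp add: abs_sgn)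
    then have "\<eta> j * (\<sigma> * \<delta> j) = \<bar>\<eta> j\<bar> * \<sigma> * c * (1 + l / \<bar>\<eta> j\<bar>)"
      by (simp add: \<delta>_def mult_ac)
    also have "\<dots> = \<zeta> j" using \<eta>[OF that] by (simp add: \<zeta>_def field_simps)
    finally show ?thesis .
  qed
  have risk_le: "(\<integral>\<^sup>+x. ennreal ((T' (\<lambda>j\<in>?I. (if j \<in> B then \<delta> j else 0) + x j) - (\<Sum>j\<in>B. \<zeta> j))\<^sup>2) \<partial>PiM ?I (\<lambda>_. P))
      \<le> max_risk d \<eta> \<sigma> \<alpha> \<tau> T n" if B: "B \<subseteq> ?I" "card B \<le> n" for B n
  proof -
    define \<theta> where "\<theta> = (\<lambda>j\<in>?I. \<sigma> * (if j \<in> B then \<delta> j else 0))"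
    have "{j \<in> ?I. \<theta> j \<noteq> 0} \<subseteq> B" by (auto simp: \<theta>_def split: if_splits)
    then have "card {j \<in> ?I. \<theta> j \<noteq> 0} \<le> n"
      using B card_mono finite_subset by (metis finite_atLeastAtMost le_trans)
    then have \<theta>: "\<theta> \<in> sparse_class d n" by (auto simp: sparse_class_def \<theta>_def)
    have lin: "lin_fun d \<eta> \<theta> = (\<Sum>j\<in>B. \<zeta> j)"
      unfolding lin_fun_def using B \<eta>\<delta> by (intro sum.mono_neutral_cong_right) (auto simp: \<theta>_def)
    have "risk d \<eta> \<sigma> T \<theta> (PiM ?I (\<lambda>_. P)) =
      (\<integral>\<^sup>+x. ennreal ((T (\<lambda>j\<in>?I. \<theta> j + \<sigma> * x j) - (\<Sum>j\<in>B. \<zeta> j))\<^sup>2) \<partial>PiM ?I (\<lambda>_. P))"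
      unfolding risk_def obs_law_def lin by (subst nn_integral_distr) auto
    also have "\<dots> = (\<integral>\<^sup>+x. ennreal ((T' (\<lambda>j\<in>?I. (if j \<in> B then \<delta> j else 0) + x j) - (\<Sum>j\<in>B. \<zeta> j))\<^sup>2) \<partial>PiM ?I (\<lambda>_. P))"
    proof (rule nn_integral_cong)
      fix x
      have "(\<lambda>j\<in>?I. \<theta> j + \<sigma> * x j) = (\<lambda>j\<in>?I. \<sigma> * (\<lambda>j\<in>?I. (if j \<in> B then \<delta> j else 0) + x j) j)"
        by (auto simp: \<theta>_def fun_eq_iff restrict_def algebra_simps)
      then show "ennreal ((T (\<lambda>j\<in>?I. \<theta> j + \<sigma> * x j) - (\<Sum>j\<in>B. \<zeta> j))\<^sup>2) =
        ennreal ((T' (\<lambda>j\<in>?I. (if j \<in> B then \<delta> j else 0) + x j) - (\<Sum>j\<in>B. \<zeta> j))\<^sup>2)"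
        by (simp add: T'_def)
    qed
    finally have "(\<integral>\<^sup>+x. ennreal ((T' (\<lambda>j\<in>?I. (if j \<in> B then \<delta> j else 0) + x j) - (\<Sum>j\<in>B. \<zeta> j))\<^sup>2) \<partial>PiM ?I (\<lambda>_. P)) =
      risk d \<eta> \<sigma> T \<theta> (PiM ?I (\<lambda>_. P))" ..
    also have "\<dots> \<le> max_risk d \<eta> \<sigma> \<alpha> \<tau> T n"
      unfolding max_risk_def by (rule SUP_upper2[OF \<theta> SUP_upper[OF PQ]])
    finally show ?thesis .
  qed
  have zero: "(\<integral>\<^sup>+x. ennreal ((T' x)\<^sup>2) \<partial>PiM ?I (\<lambda>_. P)) \<le> ennreal R0"
  proof -
    have "(\<integral>\<^sup>+x. ennreal ((T' x)\<^sup>2) \<partial>PiM ?I (\<lambda>_. P)) =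
      (\<integral>\<^sup>+x. ennreal ((T' (\<lambda>j\<in>?I. (if j \<in> {} then \<delta> j else 0) + x j) - (\<Sum>j\<in>{}. \<zeta> j))\<^sup>2) \<partial>PiM ?I (\<lambda>_. P))"
    proof (rule nn_integral_cong)
      fix x assume "x \<in> space (PiM ?I (\<lambda>_. P))"
      then have "x = (\<lambda>j\<in>?I. (if j \<in> {} then \<delta> j else 0) + x j)"
        by (auto simp: space_PiM PiE_iff extensional_def fun_eq_iff)
      then show "ennreal ((T' x)\<^sup>2) =
        ennreal ((T' (\<lambda>j\<in>?I. (if j \<in> {} then \<delta> j else 0) + x j) - (\<Sum>j\<in>{}. \<zeta> j))\<^sup>2)" by simp
    qed
    also have "\<dots> \<le> ennreal R0" by (rule order_trans[OF risk_le R0]) auto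
    finally show ?thesis .
  qed
  have M0: "M > 0" using M by (rule less_le_trans[rotated]) simp
  \<comment> \<open>The parameters \<open>a = D / 4\<close> and \<open>b = D / (2 * M)\<close> hold
    the first two terms together and the third term to \<open>D / 4\<close> each, so half of
    \<open>D\<close> is left for the term with \<open>R0\<close>.\<close>
  have "(\<Sum>j\<in>?I. p j * \<zeta> j) / 2 \<le>
    (D / 4) / 2 + R1 / (2 * (D / 4)) + (D / (2 * M)) / 2 * exp (\<Sum>j\<in>?I. (p j)\<^sup>2 * \<rho> j) + R0 / (2 * (D / (2 * M)))"
  proof (rule mixture_mean_le_risks[where f = f and T = T' and \<delta> = \<delta> and s = r])
    show "prob_space (density lborel (\<lambda>x. ennreal (f x)))"
      using noise by (simp add: noise_class_def P_def)
    fix B assume "B \<subseteq> ?I" "card B \<le> r"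
    then show "(\<integral>\<^sup>+x. ennreal ((T' (\<lambda>j\<in>?I. (if j \<in> B then \<delta> j else 0) + x j) - sum \<zeta> B)\<^sup>2)
      \<partial>PiM ?I (\<lambda>_. density lborel (\<lambda>x. ennreal (f x)))) \<le> ennreal R1"
      using risk_le R1 order_trans unfolding P_def by blast
  qed (use f_meas f p \<rho> abs_\<delta> \<rho>0 T'_meas pos r zero R D(1) M0 in \<open>auto simp: \<zeta>_def P_def\<close>)
  also have "(\<Sum>j\<in>?I. p j * \<zeta> j) / 2 = \<sigma> * c * (\<Sum>j\<in>?I. p j * (\<bar>\<eta> j\<bar> + l)) / 2"
    by (simp add: \<zeta>_def sum_distrib_left mult_ac)
  finally have main: "D \<le> (D / 4) / 2 + R1 / (2 * (D / 4)) + (D / (2 * M)) / 2 * exp (\<Sum>j\<in>?I. (p j)\<^sup>2 * \<rho> j) + R0 / (2 * (D / (2 * M)))"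
    using D(2) by linarith
  have "R1 / (2 * (D / 4)) \<le> (D\<^sup>2 / 16) / (2 * (D / 4))"
    using D by (intro divide_right_mono) auto
  also have "\<dots> = D / 8" using D(1) by (simp add: power2_eq_square)
  finally have x: "R1 / (2 * (D / 4)) \<le> D / 8" .
  have "(D / (2 * M)) / 2 * exp (\<Sum>j\<in>?I. (p j)\<^sup>2 * \<rho> j) \<le> (D / (2 * M)) / 2 * M"
    using D(1) M0 M by (intro mult_left_mono) auto
  also have "\<dots> = D / 4" using M0 by simp
  finally have y: "(D / (2 * M)) / 2 * exp (\<Sum>j\<in>?I. (p j)\<^sup>2 * \<rho> j) \<le> D / 4" .
  have z: "R0 / (2 * (D / (2 * M))) = R0 * M / D" using D(1) M0 by simp
  have "D / 2 \<le> v" if "D \<le> (D / 4) / 2 + t + u + v" "t \<le> D / 8" "u \<le> D / 4" for t u v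
    using that by linarith
  from this[OF main[unfolded z] x y] have "D / 2 \<le> R0 * M / D" .
  then have "D / 2 * D \<le> R0 * M" using D(1) by (simp add: pos_le_divide_eq)
  then show ?thesis by (simp add: power2_eq_square mult_ac)
qed

section \<open>The thresholds\<close>

text \<open>The pair sum is symmetrised; every term then has a sign, as in Chebyshev's sum inequality.\<close>

lemma weighted_mean_inverse_tilt_le:
  fixes a :: "'i \<Rightarrow> real"
  assumes I: "finite I" and a: "\<And>j. j \<in> I \<Longrightarrow> a j > 0" and "\<alpha> > 0" and "\<beta> \<le> \<beta>'"
  shows "(\<Sum>j\<in>I. a j * exp (- \<beta>' / a j powr \<alpha>)) * (\<Sum>j\<in>I. (a j)\<^sup>2 * exp (- \<beta> / a j powr \<alpha>)) \<le>
    (\<Sum>j\<in>I. a j * exp (- \<beta> / a j powr \<alpha>)) * (\<Sum>j\<in>I. (a j)\<^sup>2 * exp (- \<beta>' / a j powr \<alpha>))"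
proof -
  define e where "e j = exp (- \<beta> / a j powr \<alpha>)" for j
  define e' where "e' j = exp (- \<beta>' / a j powr \<alpha>)" for j
  define D where "D i j = e' i * e j - e i * e' j" for i j
  have D: "D i j \<le> 0" if "i \<in> I" "j \<in> I" "a i \<le> a j" for i j
  proof -
    have "a i powr \<alpha> \<le> a j powr \<alpha>" using that a[OF that(1)] assms(3) by (intro powr_mono2) auto
    then have "(\<beta>' - \<beta>) / a j powr \<alpha> \<le> (\<beta>' - \<beta>) / a i powr \<alpha>"
      using a[OF that(1)] a[OF that(2)] assms(4) by (intro divide_left_mono) auto
    then have "- \<beta>' / a i powr \<alpha> + - \<beta> / a j powr \<alpha> \<le> - \<beta> / a i powr \<alpha> + - \<beta>' / a j powr \<alpha>"
      by (simp add: diff_divide_distrib)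
    then have "e' i * e j \<le> e i * e' j"
      unfolding e_def e'_def by (simp add: mult_exp_exp)
    then show ?thesis by (simp add: D_def)
  qed
  have sgn: "a i * a j * (a j - a i) * D i j \<le> 0" if ij: "i \<in> I" "j \<in> I" for i j
  proof (cases "a i \<le> a j")
    case True
    then show ?thesis using D[OF ij True] a[OF ij(1)] a[OF ij(2)]
      by (intro mult_nonneg_nonpos) auto
  next
    case False
    then have "D j i \<le> 0" using D ij by auto
    then have "D i j \<ge> 0" by (simp add: D_def mult.commute)
    moreover have "a i * a j * (a j - a i) \<le> 0"
      using False a[OF ij(1)] a[OF ij(2)] by (intro mult_nonneg_nonpos) auto
    ultimately show ?thesis by (rule mult_nonpos_nonneg[rotated])
  qed
  define S where "S = (\<Sum>i\<in>I. \<Sum>j\<in>I. a i * (a j)\<^sup>2 * D i j)"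
  have "S = (\<Sum>j\<in>I. \<Sum>i\<in>I. a i * (a j)\<^sup>2 * D i j)" unfolding S_def by (rule sum.swap)
  also have "\<dots> = (\<Sum>i\<in>I. \<Sum>j\<in>I. - (a j * (a i)\<^sup>2 * D i j))"
    by (intro sum.cong refl) (simp add: D_def algebra_simps)
  finally have "S + S = (\<Sum>i\<in>I. \<Sum>j\<in>I. a i * (a j)\<^sup>2 * D i j) + (\<Sum>i\<in>I. \<Sum>j\<in>I. - (a j * (a i)\<^sup>2 * D i j))"
    by (simp only: S_def)
  also have "\<dots> = (\<Sum>i\<in>I. \<Sum>j\<in>I. a i * a j * (a j - a i) * D i j)"
    unfolding sum.distrib[symmetric] by (intro sum.cong refl) (simp add: power2_eq_square algebra_simps)
  also have "\<dots> \<le> 0" by (intro sum_nonpos) (auto intro: sgn)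
  finally have "S \<le> 0" by simp
  moreover have "S = (\<Sum>j\<in>I. a j * e' j) * (\<Sum>j\<in>I. (a j)\<^sup>2 * e j) - (\<Sum>j\<in>I. a j * e j) * (\<Sum>j\<in>I. (a j)\<^sup>2 * e' j)"
    unfolding sum_product S_def sum_subtractf[symmetric]
    by (intro sum.cong refl) (simp add: D_def algebra_simps)
  ultimately show ?thesis by (simp add: e_def e'_def)
qed

text \<open>Cauchy-Schwarz with each exponential split into two equal factors. Applied to
  \<open>phi\<close>, it bounds the square of \<open>phi\<close> by the plain sum of the
  exponentials.\<close>

lemma sum_weighted_square_le:
  fixes a b :: "'i \<Rightarrow> real"
  shows "(\<Sum>j\<in>I. \<bar>a j\<bar> * exp (b j))\<^sup>2 \<le> (\<Sum>j\<in>I. exp (b j)) * (\<Sum>j\<in>I. (a j)\<^sup>2 * exp (b j))"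
proof -
  have h: "exp (b j / 2) * exp (b j / 2) = exp (b j)" for j by (simp add: mult_exp_exp)
  have sq: "(exp (b j / 2))\<^sup>2 = exp (b j)" for j using h[of j] by (simp only: power2_eq_square)
  have "(\<Sum>j\<in>I. exp (b j / 2) * (\<bar>a j\<bar> * exp (b j / 2)))\<^sup>2 \<le>
      (\<Sum>j\<in>I. (exp (b j / 2))\<^sup>2) * (\<Sum>j\<in>I. (\<bar>a j\<bar> * exp (b j / 2))\<^sup>2)"
    by (rule Cauchy_Schwarz_ineq_sum)
  moreover have "exp (b j / 2) * (\<bar>a j\<bar> * exp (b j / 2)) = \<bar>a j\<bar> * exp (b j)" for j
    using h[of j] by simp
  ultimately show ?thesis by (simp only: power_mult_distrib power2_abs sq)
qed

section \<open>Solvability of the threshold equation and its clipping at zero\<close>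

context
  fixes d :: nat and \<eta> :: "nat \<Rightarrow> real" and \<alpha> :: real
  assumes d: "d \<ge> 1" and \<eta>: "\<And>j. j \<in> {1..d} \<Longrightarrow> \<bar>\<eta> j\<bar> > 0" and \<alpha>: "\<alpha> > 0"
begin

abbreviation (input) "phi_num \<beta> \<equiv> \<Sum>j=1..d. \<bar>\<eta> j\<bar> * exp (- \<beta> / \<bar>\<eta> j\<bar> powr \<alpha>)"
abbreviation (input) "phi_den \<beta> \<equiv> \<Sum>j=1..d. (\<eta> j)\<^sup>2 * exp (- \<beta> / \<bar>\<eta> j\<bar> powr \<alpha>)"

lemma phi_numerator_pos: "phi_num \<beta> > 0"
  using d \<eta> by (intro sum_pos) auto

lemma phi_denominator_pos: "phi_den \<beta> > 0"
  using d \<eta> by (intro sum_pos) auto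

lemma phi_nonneg: "phi d \<eta> \<alpha> \<beta> \<ge> 0"
  unfolding phi_def using phi_numerator_pos[of \<beta>] phi_denominator_pos[of \<beta>] by (intro divide_nonneg_nonneg) auto

lemma phi_square: "(phi d \<eta> \<alpha> \<beta>)\<^sup>2 = (phi_num \<beta>)\<^sup>2 / phi_den \<beta>"
  unfolding phi_def power_divide using phi_denominator_pos[of \<beta>] by simp

text \<open>The square of \<open>phi\<close> is the numerator times its ratio to the sum under the
  root. The numerator decreases strictly and the ratio does not increase, by the tilting
  inequality.\<close>

lemma phi_strict_antimono:
  assumes "\<beta> < \<beta>'"
  shows "phi d \<eta> \<alpha> \<beta>' < phi d \<eta> \<alpha> \<beta>"
proof -
  have A: "phi_num \<beta>' < phi_num \<beta>"
    using d \<eta> assms by (intro sum_strict_mono) (auto simp: divide_strict_right_mono)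
  have "phi_num \<beta>' * phi_den \<beta> \<le> phi_num \<beta> * phi_den \<beta>'"
    using weighted_mean_inverse_tilt_le[of "{1..d}" "\<lambda>j. \<bar>\<eta> j\<bar>" \<alpha> \<beta> \<beta>'] \<eta> \<alpha> assms by simp
  moreover have "x / y \<le> z / w" if "x * w \<le> z * y" "y > 0" "w > 0" for x y z w :: real
    using that by (simp add: field_simps)
  ultimately have "phi_num \<beta>' / phi_den \<beta>' \<le> phi_num \<beta> / phi_den \<beta>"
    using phi_denominator_pos by blast
  with A have "phi_num \<beta>' * (phi_num \<beta>' / phi_den \<beta>') < phi_num \<beta> * (phi_num \<beta> / phi_den \<beta>)"
    using phi_numerator_pos[of \<beta>'] phi_numerator_pos[of \<beta>] phi_denominator_pos[of \<beta>] phi_denominator_pos[of \<beta>']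
    by (intro mult_less_le_imp_less) auto
  then have "(phi d \<eta> \<alpha> \<beta>')\<^sup>2 < (phi d \<eta> \<alpha> \<beta>)\<^sup>2"
    unfolding phi_square by (simp add: power2_eq_square)
  then show ?thesis using phi_nonneg by (rule power2_less_imp_less)
qed

lemma continuous_on_phi: "continuous_on X (phi d \<eta> \<alpha>)"
proof -
  have "sqrt (phi_den \<beta>) \<noteq> 0" for \<beta> using phi_denominator_pos[of \<beta>] by simp
  moreover have "\<forall>j\<in>{1..d}. \<bar>\<eta> j\<bar> powr \<alpha> \<noteq> 0" using \<eta> by auto
  ultimately show ?thesis unfolding phi_def by (intro continuous_intros) auto
qed

text \<open>With \<open>m\<close> the sum of all \<open>\<bar>\<eta> j\<bar>\<close>, the sum under
  the root is at most \<open>m\<close> times the numerator, so the square of \<open>phi\<close> is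
  at least the numerator over \<open>m\<close>. The first term alone makes the numerator large
  enough; \<open>y\<close> is the value its exponential must take.\<close>

lemma exists_phi_ge:
  assumes "v > 0"
  shows "\<exists>\<beta>. phi d \<eta> \<alpha> \<beta> \<ge> v"
proof -
  define m where "m = (\<Sum>j=1..d. \<bar>\<eta> j\<bar>)"
  have d1: "1 \<in> {1..d}" using d by simp
  have le_m: "\<bar>\<eta> j\<bar> \<le> m" if "j \<in> {1..d}" for j
    unfolding m_def using that by (intro member_le_sum) auto
  have m: "m > 0" using le_m[OF d1] \<eta>[OF d1] by linarith
  define y where "y = m * v\<^sup>2 / \<bar>\<eta> 1\<bar>"
  have y: "y > 0" using m assms \<eta>[OF d1] by (simp add: y_def)
  define \<beta> where "\<beta> = - (\<bar>\<eta> 1\<bar> powr \<alpha> * ln y)"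
  have "- \<beta> / \<bar>\<eta> 1\<bar> powr \<alpha> = ln y" using \<eta>[OF d1] by (simp add: \<beta>_def)
  then have "m * v\<^sup>2 = \<bar>\<eta> 1\<bar> * exp (- \<beta> / \<bar>\<eta> 1\<bar> powr \<alpha>)"
    using y \<eta>[OF d1] by (simp add: y_def)
  also have "\<dots> \<le> phi_num \<beta>" using d1 by (intro member_le_sum) auto
  finally have A: "m * v\<^sup>2 \<le> phi_num \<beta>" .
  have "phi_den \<beta> \<le> (\<Sum>j=1..d. m * (\<bar>\<eta> j\<bar> * exp (- \<beta> / \<bar>\<eta> j\<bar> powr \<alpha>)))"
  proof (rule sum_mono)
    fix j assume "j \<in> {1..d}"
    then have "\<bar>\<eta> j\<bar> * (\<bar>\<eta> j\<bar> * exp (- \<beta> / \<bar>\<eta> j\<bar> powr \<alpha>)) \<le> m * (\<bar>\<eta> j\<bar> * exp (- \<beta> / \<bar>\<eta> j\<bar> powr \<alpha>))"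
      by (intro mult_right_mono le_m) auto
    then show "(\<eta> j)\<^sup>2 * exp (- \<beta> / \<bar>\<eta> j\<bar> powr \<alpha>) \<le> m * (\<bar>\<eta> j\<bar> * exp (- \<beta> / \<bar>\<eta> j\<bar> powr \<alpha>))"
      by (simp add: power2_eq_square mult.assoc[symmetric] flip: abs_mult)
  qed
  then have "phi_den \<beta> \<le> m * phi_num \<beta>" by (simp add: sum_distrib_left)
  then have "v\<^sup>2 * phi_den \<beta> \<le> v\<^sup>2 * (m * phi_num \<beta>)" by (intro mult_left_mono) auto
  also have "\<dots> = (m * v\<^sup>2) * phi_num \<beta>" by simp
  also have "\<dots> \<le> phi_num \<beta> * phi_num \<beta>" using A phi_numerator_pos[of \<beta>] by (intro mult_right_mono) auto
  finally have "v\<^sup>2 \<le> (phi d \<eta> \<alpha> \<beta>)\<^sup>2"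
    unfolding phi_square using phi_denominator_pos[of \<beta>] by (simp add: pos_le_divide_eq power2_eq_square)
  then have "v \<le> phi d \<eta> \<alpha> \<beta>" using phi_nonneg by (rule power2_le_imp_le)
  then show ?thesis ..
qed

text \<open>The square of \<open>phi\<close> is at most the sum of the exponentials, a finite sum of
  terms tending to 0.\<close>

lemma exists_phi_le:
  assumes "v > 0"
  shows "\<exists>\<beta>. phi d \<eta> \<alpha> \<beta> \<le> v"
proof -
  have lim: "((\<lambda>\<beta>. \<Sum>j=1..d. exp (- \<beta> / \<bar>\<eta> j\<bar> powr \<alpha>)) \<longlongrightarrow> (\<Sum>j=1..d. 0)) at_top"
  proof (rule tendsto_sum)
    fix j assume "j \<in> {1..d}"
    then have "\<bar>\<eta> j\<bar> powr \<alpha> > 0" using \<eta> by simp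
    moreover have "((\<lambda>\<beta>. exp (- \<beta> / c)) \<longlongrightarrow> 0) at_top" if "c > 0" for c :: real
      using that by real_asymp
    ultimately show "((\<lambda>\<beta>. exp (- \<beta> / \<bar>\<eta> j\<bar> powr \<alpha>)) \<longlongrightarrow> 0) at_top" by blast
  qed
  have "(\<Sum>j=1..d. 0::real) < v\<^sup>2" using assms by simp
  with lim have "\<forall>\<^sub>F \<beta> in at_top. (\<Sum>j=1..d. exp (- \<beta> / \<bar>\<eta> j\<bar> powr \<alpha>)) < v\<^sup>2"
    by (rule order_tendstoD(2))
  then obtain \<beta> where \<beta>: "(\<Sum>j=1..d. exp (- \<beta> / \<bar>\<eta> j\<bar> powr \<alpha>)) < v\<^sup>2"
    using eventually_happens'[OF trivial_limit_at_top_linorder] by blast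
  have "(phi_num \<beta>)\<^sup>2 \<le> (\<Sum>j=1..d. exp (- \<beta> / \<bar>\<eta> j\<bar> powr \<alpha>)) * phi_den \<beta>"
    by (rule sum_weighted_square_le)
  also have "(\<Sum>j=1..d. exp (- \<beta> / \<bar>\<eta> j\<bar> powr \<alpha>)) * phi_den \<beta> \<le> v\<^sup>2 * phi_den \<beta>"
    using less_imp_le[OF \<beta>] less_imp_le[OF phi_denominator_pos] by (rule mult_right_mono)
  finally have "(phi_num \<beta>)\<^sup>2 \<le> v\<^sup>2 * phi_den \<beta>" .
  then have "(phi d \<eta> \<alpha> \<beta>)\<^sup>2 \<le> v\<^sup>2"
    unfolding phi_square using phi_denominator_pos[of \<beta>] by (simp add: pos_divide_le_eq)
  then have "phi d \<eta> \<alpha> \<beta> \<le> v" using less_imp_le[OF assms] by (rule power2_le_imp_le)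
  then show ?thesis ..
qed

text \<open>Existence by the intermediate value theorem, uniqueness by strict monotonicity; this
  gives the definite descriptions in both thresholds their meaning.\<close>

lemma phi_the:
  assumes "v > 0"
  shows "phi d \<eta> \<alpha> (THE \<beta>. phi d \<eta> \<alpha> \<beta> = v) = v"
proof -
  obtain \<beta>1 where 1: "phi d \<eta> \<alpha> \<beta>1 \<ge> v" using exists_phi_ge[OF assms] ..
  obtain \<beta>2 where 2: "phi d \<eta> \<alpha> \<beta>2 \<le> v" using exists_phi_le[OF assms] ..
  have "\<exists>\<beta>. phi d \<eta> \<alpha> \<beta> = v"
  proof (cases "\<beta>1 \<le> \<beta>2")
    case True
    then show ?thesis using IVT2'[OF 2 1 True continuous_on_phi] by blast
  next
    case False
    then have "phi d \<eta> \<alpha> \<beta>1 < phi d \<eta> \<alpha> \<beta>2" by (intro phi_strict_antimono) auto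
    with 1 2 show ?thesis by linarith
  qed
  moreover have "x = y" if "phi d \<eta> \<alpha> x = v" "phi d \<eta> \<alpha> y = v" for x y
    using that phi_strict_antimono[of x y] phi_strict_antimono[of y x] by (cases x y rule: linorder_cases) auto
  ultimately have "\<exists>!\<beta>. phi d \<eta> \<alpha> \<beta> = v" by blast
  then show ?thesis by (rule theI')
qed

text \<open>Raising \<open>l / \<bar>\<eta> j\<bar>\<close> to the power \<alpha> turns the
  exponents into those of \<open>phi\<close> at \<open>max \<beta> 0\<close>. Moving a negative root
  up to 0 only lowers \<open>phi\<close>, hence the inequality; a positive \<open>l\<close> means
  that no clipping occurred, hence the equality.\<close>

lemma phi_threshold:
  fixes v :: real
  assumes "v > 0"
  defines "l \<equiv> (max (THE \<beta>. phi d \<eta> \<alpha> \<beta> = v) 0) powr (1 / \<alpha>)"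
  defines "V \<equiv> \<Sum>j=1..d. (\<eta> j)\<^sup>2 * exp (- ((l / \<bar>\<eta> j\<bar>) powr \<alpha>))"
  shows "V > 0" "(\<Sum>j=1..d. \<bar>\<eta> j\<bar> * exp (- ((l / \<bar>\<eta> j\<bar>) powr \<alpha>))) \<le> v * sqrt V"
    "l > 0 \<Longrightarrow> (\<Sum>j=1..d. \<bar>\<eta> j\<bar> * exp (- ((l / \<bar>\<eta> j\<bar>) powr \<alpha>))) = v * sqrt V"
proof -
  define \<beta> where "\<beta> = (THE \<beta>. phi d \<eta> \<alpha> \<beta> = v)"
  have \<beta>: "phi d \<eta> \<alpha> \<beta> = v" unfolding \<beta>_def using assms by (intro phi_the)
  have l: "l = (max \<beta> 0) powr (1 / \<alpha>)" by (simp add: l_def \<beta>_def)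
  have e: "- ((l / \<bar>\<eta> j\<bar>) powr \<alpha>) = - (max \<beta> 0) / \<bar>\<eta> j\<bar> powr \<alpha>" if "j \<in> {1..d}" for j
    using \<alpha> by (simp add: l powr_divide powr_powr)
  have V: "V = phi_den (max \<beta> 0)" unfolding V_def using e by (intro sum.cong) auto
  have A: "(\<Sum>j=1..d. \<bar>\<eta> j\<bar> * exp (- ((l / \<bar>\<eta> j\<bar>) powr \<alpha>))) = phi_num (max \<beta> 0)"
    using e by (intro sum.cong) auto
  show V0: "V > 0" unfolding V by (rule phi_denominator_pos)
  have phi: "phi d \<eta> \<alpha> (max \<beta> 0) = phi_num (max \<beta> 0) / sqrt V" by (simp add: phi_def V)
  have "phi d \<eta> \<alpha> (max \<beta> 0) \<le> v"
    using \<beta> phi_strict_antimono[of \<beta> 0] by (cases \<beta> "0::real" rule: linorder_cases) auto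
  then show "(\<Sum>j=1..d. \<bar>\<eta> j\<bar> * exp (- ((l / \<bar>\<eta> j\<bar>) powr \<alpha>))) \<le> v * sqrt V"
    unfolding phi A using V0 by (simp add: pos_divide_le_eq)
  assume "l > 0"
  then have "max \<beta> 0 = \<beta>" unfolding l by (auto simp: max_def split: if_splits)
  then have "phi_num (max \<beta> 0) / sqrt V = v" using \<beta> phi by simp
  then show "(\<Sum>j=1..d. \<bar>\<eta> j\<bar> * exp (- ((l / \<bar>\<eta> j\<bar>) powr \<alpha>))) = v * sqrt V"
    unfolding A using V0 by (simp add: field_simps)
qed

end

section \<open>The lower bound\<close>

lemma ln_exp_mult: "x > 0 \<Longrightarrow> ln (exp 1 * x) = 1 + ln (x::real)"
  by (simp add: ln_mult)

text \<open>A logarithm is dominated by the power \<gamma>/2, whatever the exponent. This lets the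
  factor \<open>s powr \<gamma>\<close> absorb the squared logarithms of the adaptive rate.\<close>

lemma ln_exp_mult_square_le:
  fixes \<gamma> x :: real
  assumes \<gamma>: "0 < \<gamma>" "\<gamma> < 2" and x: "x \<ge> 1"
  shows "(ln (exp 1 * x))\<^sup>2 \<le> (2 / \<gamma>)\<^sup>2 * exp 2 * x powr \<gamma>"
proof -
  have ge: "exp 1 * x \<ge> 1" using x one_le_exp_iff[of 1] mult_mono[of 1 "exp 1" 1 x] by simp
  then have "ln (exp 1 * x) \<le> (exp 1 * x) powr (\<gamma> / 2) / (\<gamma> / 2)"
    using \<gamma> by (intro ln_powr_bound) auto
  then have "(ln (exp 1 * x))\<^sup>2 \<le> ((exp 1 * x) powr (\<gamma> / 2) / (\<gamma> / 2))\<^sup>2"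
    using ge by (intro power_mono) auto
  also have "\<dots> = (2 / \<gamma>)\<^sup>2 * (exp 1 * x) powr \<gamma>"
    using \<gamma> ge by (simp add: power_divide power2_eq_square flip: powr_add)
  also have "(exp 1 * x) powr \<gamma> = exp \<gamma> * x powr \<gamma>" using x by (simp add: powr_mult exp_powr_real)
  also have "(2 / \<gamma>)\<^sup>2 * (exp \<gamma> * x powr \<gamma>) \<le> (2 / \<gamma>)\<^sup>2 * (exp 2 * x powr \<gamma>)"
    using \<gamma> by (intro mult_left_mono mult_right_mono) auto
  finally show ?thesis by (simp add: mult.assoc)
qed

lemma max_risk_mono:
  assumes "m \<le> n"
  shows "max_risk d \<eta> \<sigma> \<alpha> \<tau> T m \<le> max_risk d \<eta> \<sigma> \<alpha> \<tau> T n"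
  unfolding max_risk_def using assms by (intro SUP_subset_mono) (auto simp: sparse_class_def)

text \<open>\<open>X\<close> is the part of the rate that the thinned prior attains. It is the full
  rate unless thinning removed an index; then only the threshold part is kept, but
  \<open>L > 1\<close> and a single coordinate accounts for the missing part up to logarithms. For
  \<open>r = 1\<close> the logarithm is 1 and this alternative cannot occur.\<close>

lemma rate_risk_tradeoff:
  fixes f :: "real \<Rightarrow> real" and \<eta> :: "nat \<Rightarrow> real" and r :: nat
  assumes "f \<in> borel_measurable borel" "\<And>x. f x > 0"
    and noise: "density lborel (\<lambda>x. ennreal (f x)) \<in> noise_class \<alpha> \<tau>"
    and chi: "\<And>t \<delta>. t \<ge> 0 \<Longrightarrow> \<bar>\<delta>\<bar> = c * (1 + t) \<Longrightarrow>
      (\<integral>\<^sup>+x. ennreal ((f (x - \<delta>))\<^sup>2 / f x) \<partial>lborel) \<le> ennreal (K * exp (t powr \<alpha>))"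
    and pos: "\<alpha> > 0" "c > 0" "K > 0" "\<sigma> > 0"
    and k: "0 < k" "k \<le> 1/4" "K * k\<^sup>2 \<le> \<gamma>" "K * k\<^sup>2 \<le> 1"
    and d: "d \<ge> 1" and \<eta>: "\<And>j. j \<in> {1..d} \<Longrightarrow> \<bar>\<eta> j\<bar> > 0"
    and T: "T \<in> estimators d" and r: "r \<ge> 1"
  obtains X where "X \<ge> 0"
    "X = r * lambda_star d \<eta> \<alpha> r + nu_star d \<eta> \<alpha> r \<or>
     X = r * lambda_star d \<eta> \<alpha> r \<and> ln (exp 1 * r) > 1 \<and>
       (\<exists>j\<in>{1..d}. (nu_star d \<eta> \<alpha> r)\<^sup>2 \<le> (ln (exp 1 * r))\<^sup>2 * (\<eta> j)\<^sup>2)"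
    "\<And>R0 R1. R0 \<ge> 0 \<Longrightarrow> R1 \<ge> 0 \<Longrightarrow> max_risk d \<eta> \<sigma> \<alpha> \<tau> T r \<le> ennreal R1 \<Longrightarrow>
      max_risk d \<eta> \<sigma> \<alpha> \<tau> T 1 \<le> ennreal R0 \<Longrightarrow> R1 \<le> (\<sigma> * (c * k / 8) * X)\<^sup>2 / 16 \<Longrightarrow>
      (\<sigma> * (c * k / 8) * X)\<^sup>2 \<le> 2 * exp 1 * real r powr \<gamma> * R0"
proof -
  define L where "L = ln (exp 1 * real r)"
  define l where "l = lambda_star d \<eta> \<alpha> r"
  define e where "e j = exp (- ((l / \<bar>\<eta> j\<bar>) powr \<alpha>))" for j
  define V where "V = (\<Sum>j=1..d. (\<eta> j)\<^sup>2 * e j)"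
  have L_eq: "L = 1 + ln (real r)" using r by (simp add: L_def ln_exp_mult)
  have L: "1 \<le> L" "L \<le> real r"
    using r ln_le_minus_one[of "real r"] by (auto simp: L_eq)
  have \<nu>: "nu_star d \<eta> \<alpha> r = sqrt (L * V)" by (simp add: nu_star_def L_def V_def e_def l_def)
  have v: "real r / (2 * sqrt L) > 0" using r L by simp
  have l_eq: "l = (max (THE \<beta>. phi d \<eta> \<alpha> \<beta> = real r / (2 * sqrt L)) 0) powr (1 / \<alpha>)"
    by (simp add: l_def lambda_star_def beta_star_def L_def)
  have thr: "V > 0" "(\<Sum>j=1..d. \<bar>\<eta> j\<bar> * e j) \<le> r / (2 * sqrt L) * sqrt V"
    "l > 0 \<Longrightarrow> (\<Sum>j=1..d. \<bar>\<eta> j\<bar> * e j) = r / (2 * sqrt L) * sqrt V"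
    using phi_threshold[of d \<eta> \<alpha> "real r / (2 * sqrt L)"] d \<eta> pos(1) v
    unfolding V_def e_def l_eq by blast+
  have l0: "l \<ge> 0" by (simp add: l_eq)
  have e01: "0 < e j \<and> e j \<le> 1" if "j \<in> {1..d}" for j by (simp add: e_def)
  obtain p where p: "\<And>j. j \<in> {1..d} \<Longrightarrow> 0 \<le> p j \<and> p j \<le> 1" "(\<Sum>j=1..d. p j) \<le> r / 2"
    "(\<Sum>j=1..d. (p j)\<^sup>2 / e j) \<le> k\<^sup>2 * L"
    "(\<Sum>j=1..d. \<bar>\<eta> j\<bar> * e j) = r / (2 * sqrt L) * sqrt V \<Longrightarrow> k * r / 4 \<le> (\<Sum>j=1..d. p j)"
    "(\<Sum>j=1..d. p j * \<bar>\<eta> j\<bar>) = k * sqrt (L * V) \<or> (\<exists>j\<in>{1..d}. V \<le> k\<^sup>2 * L * (\<eta> j)\<^sup>2 \<and> 1 < k\<^sup>2 * L)"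
    using exists_thinned_weights[OF finite_atLeastAtMost e01 V_def thr(1) k(1,2) L thr(2)] by blast
  \<comment> \<open>The lower bound on the total weight needs equality in the threshold equation,
    which holds for \<open>l > 0\<close>; for \<open>l = 0\<close> the claim is trivial.\<close>
  have lp: "k * (r * l) / 4 \<le> (\<Sum>j=1..d. p j * l)"
  proof (cases "l > 0")
    case True
    then have "k * r / 4 * l \<le> (\<Sum>j=1..d. p j) * l"
      using p(4)[OF thr(3)] by (intro mult_right_mono) auto
    then show ?thesis unfolding sum_distrib_right by (simp add: mult_ac)
  next
    case False
    then show ?thesis using l0 by simp
  qed
  have p\<eta>0: "(\<Sum>j=1..d. p j * \<bar>\<eta> j\<bar>) \<ge> 0" using p(1) by (intro sum_nonneg) auto
  have \<nu>0: "nu_star d \<eta> \<alpha> r \<ge> 0" using L thr(1) by (simp add: \<nu>)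
  \<comment> \<open>Since \<open>L = 1 + ln r\<close>, the exponent \<open>K * k\<^sup>2 * L\<close>
    splits into a part at most 1 and a part at most \<open>\<gamma> * ln r\<close>. This is where
    the smallness of \<open>k\<close> buys a second moment polynomial in \<open>r\<close>.\<close>
  have M: "exp (\<Sum>j=1..d. (p j)\<^sup>2 * (K * exp ((l / \<bar>\<eta> j\<bar>) powr \<alpha>))) \<le> exp 1 * real r powr \<gamma>"
  proof -
    have "(\<Sum>j=1..d. (p j)\<^sup>2 * (K * exp ((l / \<bar>\<eta> j\<bar>) powr \<alpha>))) = K * (\<Sum>j=1..d. (p j)\<^sup>2 / e j)"
      by (simp add: sum_distrib_left e_def exp_minus field_simps)
    also have "\<dots> \<le> K * (k\<^sup>2 * L)" using pos by (intro mult_left_mono p(3)) auto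
    also have "\<dots> = K * k\<^sup>2 + K * k\<^sup>2 * ln (real r)" by (simp add: L_eq algebra_simps)
    also have "\<dots> \<le> 1 + \<gamma> * ln (real r)" using k r by (intro add_mono mult_right_mono) auto
    finally have "exp (\<Sum>j=1..d. (p j)\<^sup>2 * (K * exp ((l / \<bar>\<eta> j\<bar>) powr \<alpha>))) \<le> exp (1 + \<gamma> * ln (real r))"
      by simp
    also have "\<dots> = exp 1 * real r powr \<gamma>" using r by (simp add: exp_add powr_def)
    finally show ?thesis .
  qed
  \<comment> \<open>The factor 1/8 combines the 1/4 lost in the prior mean with the 1/2 lost to
    truncation.\<close>
  have key: "(\<sigma> * (c * k / 8) * X)\<^sup>2 \<le> 2 * exp 1 * real r powr \<gamma> * R0"
    if X: "X \<ge> 0" "k * X / 4 \<le> (\<Sum>j=1..d. p j * (\<bar>\<eta> j\<bar> + l))" and R: "R0 \<ge> 0" "R1 \<ge> 0"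
      "max_risk d \<eta> \<sigma> \<alpha> \<tau> T r \<le> ennreal R1" "max_risk d \<eta> \<sigma> \<alpha> \<tau> T 1 \<le> ennreal R0"
      "R1 \<le> (\<sigma> * (c * k / 8) * X)\<^sup>2 / 16" for X R0 R1
  proof (cases "X = 0")
    case True
    then show ?thesis using R by simp
  next
    case False
    have "(\<sigma> * (c * k / 8) * X)\<^sup>2 \<le> 2 * (exp 1 * real r powr \<gamma>) * R0"
    proof (rule sparse_prior_risk[OF assms(1,2) noise _ _ \<eta> pos(4,2) l0 T r p(1,2) R(3,4,1,2) M])
      show "0 < \<sigma> * (c * k / 8) * X" using False X pos k by simp
      have "\<sigma> * c / 2 * (k * X / 4) \<le> \<sigma> * c / 2 * (\<Sum>j=1..d. p j * (\<bar>\<eta> j\<bar> + l))"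
        using pos by (intro mult_left_mono X) auto
      then show "\<sigma> * (c * k / 8) * X \<le> \<sigma> * c * (\<Sum>j=1..d. p j * (\<bar>\<eta> j\<bar> + l)) / 2"
        by (simp add: mult_ac)
      show "R1 \<le> (\<sigma> * (c * k / 8) * X)\<^sup>2 / 16" by (rule R(5))
      fix j assume j: "j \<in> {1..d}"
      show "0 \<le> K * exp ((l / \<bar>\<eta> j\<bar>) powr \<alpha>)" using pos by simp
      fix \<delta> :: real assume "\<bar>\<delta>\<bar> = c * (1 + l / \<bar>\<eta> j\<bar>)"
      then show "(\<integral>\<^sup>+x. ennreal ((f (x - \<delta>))\<^sup>2 / f x) \<partial>lborel) \<le> ennreal (K * exp ((l / \<bar>\<eta> j\<bar>) powr \<alpha>))"
        using l0 by (intro chi) auto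
    qed
    then show ?thesis by (simp add: mult.assoc)
  qed
  have split: "(\<Sum>j=1..d. p j * (\<bar>\<eta> j\<bar> + l)) = (\<Sum>j=1..d. p j * \<bar>\<eta> j\<bar>) + (\<Sum>j=1..d. p j * l)"
    by (simp add: distrib_left sum.distrib)
  from p(5) show ?thesis
  proof
    assume eq: "(\<Sum>j=1..d. p j * \<bar>\<eta> j\<bar>) = k * sqrt (L * V)"
    let ?X = "r * l + nu_star d \<eta> \<alpha> r"
    have "k * ?X / 4 \<le> (\<Sum>j=1..d. p j * (\<bar>\<eta> j\<bar> + l))"
      unfolding split eq \<nu>[symmetric] using lp mult_nonneg_nonneg[OF less_imp_le[OF k(1)] \<nu>0]
      by (simp add: algebra_simps)
    then show ?thesis using l0 \<nu>0 by (intro that[of ?X] key) (auto simp: l_def)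
  next
    assume "\<exists>j\<in>{1..d}. V \<le> k\<^sup>2 * L * (\<eta> j)\<^sup>2 \<and> 1 < k\<^sup>2 * L"
    then obtain j where j: "j \<in> {1..d}" "V \<le> k\<^sup>2 * L * (\<eta> j)\<^sup>2" "1 < k\<^sup>2 * L" by auto
    have k2: "k\<^sup>2 \<le> 1" using k by (intro power_le_one) auto
    then have "k\<^sup>2 * L \<le> 1 * L" using L by (intro mult_right_mono) auto
    then have L1: "L > 1" using j by simp
    have "(nu_star d \<eta> \<alpha> r)\<^sup>2 = L * V" using L thr(1) by (simp add: \<nu>)
    also have "\<dots> \<le> L * (k\<^sup>2 * L * (\<eta> j)\<^sup>2)" using L j by (intro mult_left_mono) auto
    also have "\<dots> = k\<^sup>2 * (L\<^sup>2 * (\<eta> j)\<^sup>2)" by (simp add: power2_eq_square mult_ac)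
    also have "\<dots> \<le> 1 * (L\<^sup>2 * (\<eta> j)\<^sup>2)" using k2 by (intro mult_right_mono) auto
    finally have \<nu>j: "(nu_star d \<eta> \<alpha> r)\<^sup>2 \<le> L\<^sup>2 * (\<eta> j)\<^sup>2" by simp
    have "k * (r * l) / 4 \<le> (\<Sum>j=1..d. p j * (\<bar>\<eta> j\<bar> + l))"
      unfolding split using lp p\<eta>0 by linarith
    then show ?thesis using l0 L1 \<nu>j j(1)
      by (intro that[of "r * l"] key) (auto simp: l_def L_def)
  qed
qed

theorem theorem4:
  fixes \<alpha> \<gamma> :: real
  assumes "\<alpha> > 0" and "0 < \<gamma>" and "\<gamma> < 2"
  shows "\<exists>\<tau>\<^sub>\<alpha> C\<^sub>0 C\<^sub>2 :: real. \<tau>\<^sub>\<alpha> > 0 \<and> C\<^sub>0 > 0 \<and> C\<^sub>2 > 0 \<and>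
    (\<forall>(\<tau>::real) (d::nat) (\<eta> :: nat \<Rightarrow> real) (\<sigma>::real).
       \<tau> \<ge> \<tau>\<^sub>\<alpha> \<longrightarrow> d \<ge> 1 \<longrightarrow>
       (\<forall>i\<in>{1..d}. \<forall>j\<in>{1..d}. i \<le> j \<longrightarrow> \<bar>\<eta> i\<bar> \<ge> \<bar>\<eta> j\<bar>) \<longrightarrow>
       (\<forall>j\<in>{1..d}. \<bar>\<eta> j\<bar> > 0) \<longrightarrow>
       \<sigma> > 0 \<longrightarrow>
       (\<forall>T\<in>estimators d. \<forall>s\<in>{1..d}.
          max_risk d \<eta> \<sigma> \<alpha> \<tau> T s \<le> ennreal (\<sigma>\<^sup>2 / C\<^sub>0 * Phi_adp d \<eta> \<alpha> (real s)) \<longrightarrow>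
          max_risk d \<eta> \<sigma> \<alpha> \<tau> T 1 \<ge>
            ennreal (\<sigma>\<^sup>2 * C\<^sub>2 *
              max (Phi_adp d \<eta> \<alpha> (real s) / (min (real s) (real (s_zero d \<eta> \<alpha>))) powr \<gamma>)
                  (Phi_oracle d \<eta> \<alpha> 1))))"
proof (rule exists_noise_density[OF assms(1)])
  fix f :: "real \<Rightarrow> real" and \<tau>\<^sub>0 c K :: real
  assume f: "\<tau>\<^sub>0 > 0" "c > 0" "K > 0"
    "f \<in> borel_measurable borel" "\<And>x. f x > 0"
    "\<And>\<tau>. \<tau> \<ge> \<tau>\<^sub>0 \<Longrightarrow> density lborel (\<lambda>x. ennreal (f x)) \<in> noise_class \<alpha> \<tau>"
    "\<And>t \<delta>. t \<ge> 0 \<Longrightarrow> \<bar>\<delta>\<bar> = c * (1 + t) \<Longrightarrow>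
      (\<integral>\<^sup>+x. ennreal ((f (x - \<delta>))\<^sup>2 / f x) \<partial>lborel) \<le> ennreal (K * exp (t powr \<alpha>))"
  \<comment> \<open>The bound 1/4 is what thinning requires; the root keeps
    \<open>K * k\<^sup>2\<close> below both 1 and \<gamma>.\<close>
  define k where "k = min (1/4) (sqrt (min 1 \<gamma> / K))"
  have k: "0 < k" "k \<le> 1/4" using assms f(3) by (auto simp: k_def)
  have "k\<^sup>2 \<le> (sqrt (min 1 \<gamma> / K))\<^sup>2" using k(1) by (intro power_mono) (auto simp: k_def)
  also have "\<dots> = min 1 \<gamma> / K" using assms f(3) by simp
  finally have "K * k\<^sup>2 \<le> min 1 \<gamma>" using f(3) by (simp add: pos_le_divide_eq mult.commute)
  then have Kk: "K * k\<^sup>2 \<le> \<gamma>" "K * k\<^sup>2 \<le> 1" by auto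
  define y where "y = c * k / 8"
  have y: "y > 0" using f(2) k(1) by (simp add: y_def)
  \<comment> \<open>\<open>C\<close> is the constant of the logarithm bound.
    \<open>D = 2 * exp 1 * C\<close> is set so that, when the adaptive rate exceeds
    \<open>D * r powr \<gamma>\<close> times the oracle rate, the part of the rate lost to thinning
    is at most half of it.\<close>
  define C where "C = (2 / \<gamma>)\<^sup>2 * exp 2"
  define D where "D = 2 * exp 1 * C"
  have "1 \<le> (2 / \<gamma>)\<^sup>2" using assms by (intro one_le_power) auto
  then have C: "C \<ge> 1" using mult_mono[of 1 "(2 / \<gamma>)\<^sup>2" 1 "exp 2"] by (simp add: C_def)
  have e1: "exp (1::real) \<ge> 1" "exp (1::real) \<le> 4" using exp_le by auto
  have D: "D \<ge> 1" using C e1 mult_mono[of 1 "exp 1" 1 C] by (simp add: D_def)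
  have main: "ennreal (\<sigma>\<^sup>2 * (y\<^sup>2 / (16 * D)) *
      max (Phi_adp d \<eta> \<alpha> (real s) / (min (real s) (real (s_zero d \<eta> \<alpha>))) powr \<gamma>) (Phi_oracle d \<eta> \<alpha> 1))
      \<le> max_risk d \<eta> \<sigma> \<alpha> \<tau> T 1"
    if \<tau>: "\<tau> \<ge> \<tau>\<^sub>0" and d: "d \<ge> 1" and \<eta>: "\<And>j. j \<in> {1..d} \<Longrightarrow> \<bar>\<eta> j\<bar> > 0" and \<sigma>: "\<sigma> > 0"
      and T: "T \<in> estimators d" and s: "s \<in> {1..d}"
      and hyp: "max_risk d \<eta> \<sigma> \<alpha> \<tau> T s \<le> ennreal (\<sigma>\<^sup>2 / (32 / y\<^sup>2) * Phi_adp d \<eta> \<alpha> (real s))"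
    for \<tau> d \<eta> \<sigma> T s
  proof (cases "max_risk d \<eta> \<sigma> \<alpha> \<tau> T 1" rule: ennreal_cases)
    case top
    then show ?thesis by simp
  next
    case (real R)
    have tradeoff: "\<exists>X\<ge>0. (X = n * lambda_star d \<eta> \<alpha> n + nu_star d \<eta> \<alpha> n \<or>
        X = n * lambda_star d \<eta> \<alpha> n \<and> ln (exp 1 * n) > 1 \<and>
          (\<exists>j\<in>{1..d}. (nu_star d \<eta> \<alpha> n)\<^sup>2 \<le> (ln (exp 1 * n))\<^sup>2 * (\<eta> j)\<^sup>2)) \<and>
        (\<forall>R0\<ge>0. \<forall>R1\<ge>0. max_risk d \<eta> \<sigma> \<alpha> \<tau> T n \<le> ennreal R1 \<longrightarrow>
          max_risk d \<eta> \<sigma> \<alpha> \<tau> T 1 \<le> ennreal R0 \<longrightarrow> R1 \<le> (\<sigma> * y * X)\<^sup>2 / 16 \<longrightarrow>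
          (\<sigma> * y * X)\<^sup>2 \<le> 2 * exp 1 * real n powr \<gamma> * R0)" if "n \<ge> 1" for n :: nat
    proof (rule rate_risk_tradeoff[where \<eta> = \<eta>, OF f(4,5) f(6)[OF \<tau>] f(7) assms(1) f(2,3) \<sigma> k Kk d \<eta> T that])
      fix X :: real
      assume "X \<ge> 0"
        "X = n * lambda_star d \<eta> \<alpha> n + nu_star d \<eta> \<alpha> n \<or>
        X = n * lambda_star d \<eta> \<alpha> n \<and> ln (exp 1 * n) > 1 \<and>
          (\<exists>j\<in>{1..d}. (nu_star d \<eta> \<alpha> n)\<^sup>2 \<le> (ln (exp 1 * n))\<^sup>2 * (\<eta> j)\<^sup>2)"
        "\<And>R0 R1. R0 \<ge> 0 \<Longrightarrow> R1 \<ge> 0 \<Longrightarrow> max_risk d \<eta> \<sigma> \<alpha> \<tau> T n \<le> ennreal R1 \<Longrightarrow>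
          max_risk d \<eta> \<sigma> \<alpha> \<tau> T 1 \<le> ennreal R0 \<Longrightarrow> R1 \<le> (\<sigma> * (c * k / 8) * X)\<^sup>2 / 16 \<Longrightarrow>
          (\<sigma> * (c * k / 8) * X)\<^sup>2 \<le> 2 * exp 1 * real n powr \<gamma> * R0"
      then show ?thesis unfolding y_def by (intro exI[of _ X]) blast
    qed
    define \<Phi>o where "\<Phi>o = Phi_oracle d \<eta> \<alpha> 1"
    \<comment> \<open>The rate is constant beyond \<open>s_zero\<close>, so the prior uses only
      \<open>r\<close> coordinates; the risk on the \<open>r\<close>-sparse class is at most that on
      the \<open>s\<close>-sparse class.\<close>
    define r where "r = min s (s_zero d \<eta> \<alpha>)"
    have r: "r \<ge> 1" "r \<le> s" "real r = min (real s) (real (s_zero d \<eta> \<alpha>))"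
      using s by (auto simp: r_def s_zero_def)
    define l where "l = lambda_star d \<eta> \<alpha> (real r)"
    define \<nu> where "\<nu> = nu_star d \<eta> \<alpha> (real r)"
    define l1 where "l1 = lambda_star d \<eta> \<alpha> 1"
    define \<nu>1 where "\<nu>1 = nu_star d \<eta> \<alpha> 1"
    define L where "L = ln (exp 1 * real r)"
    \<comment> \<open>At sparsity 1 the logarithm equals 1, so the adaptive and oracle equations
      coincide.\<close>
    have l1_oracle: "lambda_oracle d \<eta> \<alpha> 1 = l1"
      by (simp add: l1_def lambda_oracle_def lambda_star_def beta_oracle_def beta_star_def)
    have \<nu>1_oracle: "nu_oracle d \<eta> \<alpha> 1 = \<nu>1"
      by (simp add: \<nu>1_def nu_oracle_def nu_star_def l1_oracle flip: l1_def)
    have \<Phi>o: "\<Phi>o = (l1 + \<nu>1)\<^sup>2" by (simp add: \<Phi>o_def Phi_oracle_def l1_oracle \<nu>1_oracle)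
    have l0: "l \<ge> 0" "l1 \<ge> 0" by (auto simp: l_def l1_def lambda_star_def)
    have \<nu>0: "\<nu>1 \<ge> 0" by (simp add: \<nu>1_oracle[symmetric] nu_oracle_def sum_nonneg)
    have \<Phi>: "Phi_star d \<eta> \<alpha> (real s) = (real r)\<^sup>2 * l\<^sup>2 + \<nu>\<^sup>2"
      by (simp add: Phi_star_def Let_def r(3) l_def \<nu>_def)
    have \<Phi>1: "Phi_star d \<eta> \<alpha> 1 = l1\<^sup>2 + \<nu>1\<^sup>2"
      by (simp add: Phi_star_def Let_def l1_def \<nu>1_def s_zero_def min_def)
    have "\<Phi>o = l1\<^sup>2 + \<nu>1\<^sup>2 + 2 * (l1 * \<nu>1)" by (simp add: \<Phi>o power2_eq_square algebra_simps)
    then have \<Phi>1_le: "Phi_star d \<eta> \<alpha> 1 \<le> \<Phi>o" using l0 \<nu>0 by (simp add: \<Phi>1)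
    have \<Phi>o0: "\<Phi>o \<ge> 0" by (simp add: \<Phi>o)
    have rg: "real r powr \<gamma> \<ge> 1" using r assms by (simp add: ge_one_powr_ge_zero)
    have L2: "L\<^sup>2 \<le> C * real r powr \<gamma>"
      unfolding L_def C_def using r by (intro ln_exp_mult_square_le assms(2,3)) auto
    \<comment> \<open>Apply the trade-off at sparsity 1 with both risks equal to \<open>R\<close>:
      either \<open>R\<close> already exceeds a sixteenth of the squared rate, or the inequality
      forces it to be at least \<open>1 / (2 * exp 1)\<close> of it.\<close>
    have R_oracle: "\<sigma>\<^sup>2 * (y\<^sup>2 / 16) * \<Phi>o \<le> R"
    proof -
      obtain X where X: "X = l1 + \<nu>1"
        "\<And>R0 R1. R0 \<ge> 0 \<Longrightarrow> R1 \<ge> 0 \<Longrightarrow> max_risk d \<eta> \<sigma> \<alpha> \<tau> T 1 \<le> ennreal R1 \<Longrightarrow>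
          max_risk d \<eta> \<sigma> \<alpha> \<tau> T 1 \<le> ennreal R0 \<Longrightarrow> R1 \<le> (\<sigma> * y * X)\<^sup>2 / 16 \<Longrightarrow> (\<sigma> * y * X)\<^sup>2 \<le> 2 * exp 1 * R0"
        using tradeoff[of 1] by (auto simp: l1_def \<nu>1_def)
      have eq: "(\<sigma> * y * X)\<^sup>2 = \<sigma>\<^sup>2 * y\<^sup>2 * \<Phi>o" by (simp add: X(1) \<Phi>o power_mult_distrib)
      show ?thesis
      proof (cases "R \<le> (\<sigma> * y * X)\<^sup>2 / 16")
        case True
        then have "(\<sigma> * y * X)\<^sup>2 \<le> 2 * exp 1 * R" using real by (intro X(2)[of R R]) auto
        also have "\<dots> \<le> 16 * R" using e1 real by (intro mult_right_mono) auto
        finally show ?thesis by (simp add: eq)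
      next
        case False
        then show ?thesis by (simp add: eq)
      qed
    qed
    \<comment> \<open>Either \<open>\<bar>\<eta> j\<bar>\<close> is below the threshold
      \<open>l1\<close>, or its exponential weight in \<open>\<nu>1\<close> is at least
      \<open>exp (- 1)\<close>.\<close>
    have \<eta>_le: "(\<eta> j)\<^sup>2 \<le> exp 1 * \<Phi>o" if j: "j \<in> {1..d}" for j
    proof (cases "l1 \<ge> \<bar>\<eta> j\<bar>")
      case True
      then have "\<bar>\<eta> j\<bar>\<^sup>2 \<le> (l1 + \<nu>1)\<^sup>2" using \<nu>0 by (intro power_mono) auto
      also have "\<dots> \<le> exp 1 * \<Phi>o" using e1 \<Phi>o0 by (simp add: \<Phi>o[symmetric] mult_le_cancel_right1)
      finally show ?thesis by simp
    next
      case False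
      then have "(l1 / \<bar>\<eta> j\<bar>) powr \<alpha> \<le> 1" using l0 assms(1) by (intro powr_le1) auto
      then have "(\<eta> j)\<^sup>2 * exp (- 1) \<le> (\<eta> j)\<^sup>2 * exp (- ((l1 / \<bar>\<eta> j\<bar>) powr \<alpha>))"
        by (intro mult_left_mono) auto
      also have "\<dots> \<le> (\<Sum>j=1..d. (\<eta> j)\<^sup>2 * exp (- ((l1 / \<bar>\<eta> j\<bar>) powr \<alpha>)))"
        using j by (intro member_le_sum) auto
      also have "\<dots> = \<nu>1\<^sup>2"
        by (simp add: \<nu>1_oracle[symmetric] nu_oracle_def l1_oracle sum_nonneg)
      also have "\<dots> \<le> \<Phi>o" unfolding \<Phi>o using l0 \<nu>0 by (intro power_mono) auto
      finally show ?thesis by (simp add: exp_minus field_simps)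
    qed
    define F where "F = Phi_adp d \<eta> \<alpha> (real s)"
    \<comment> \<open>If the adaptive rate is at most \<open>D * r powr \<gamma>\<close> times the
      oracle rate, the oracle bound suffices. Otherwise the oracle rate is negligible, and so is
      every term it controls.\<close>
    have "\<sigma>\<^sup>2 * (y\<^sup>2 / (16 * D)) * max (F / real r powr \<gamma>) \<Phi>o \<le> R"
    proof (cases "F \<le> D * real r powr \<gamma> * \<Phi>o")
      case True
      then have "F / real r powr \<gamma> \<le> D * \<Phi>o" using rg r(1) by (simp add: divide_le_eq mult_ac)
      moreover have "1 * \<Phi>o \<le> D * \<Phi>o" using D \<Phi>o0 by (intro mult_right_mono)
      ultimately have "max (F / real r powr \<gamma>) \<Phi>o \<le> D * \<Phi>o" by simp
      then have "\<sigma>\<^sup>2 * (y\<^sup>2 / (16 * D)) * max (F / real r powr \<gamma>) \<Phi>o \<le> \<sigma>\<^sup>2 * (y\<^sup>2 / (16 * D)) * (D * \<Phi>o)"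
        using D by (intro mult_left_mono) auto
      also have "\<dots> = \<sigma>\<^sup>2 * (y\<^sup>2 / 16) * \<Phi>o" using D by simp
      finally show ?thesis using R_oracle by simp
    next
      case False
      then have F_gt: "D * real r powr \<gamma> * \<Phi>o < F" by simp
      have "Phi_star d \<eta> \<alpha> 1 * L\<^sup>2 \<le> \<Phi>o * (C * real r powr \<gamma>)"
        using \<Phi>1_le L2 \<Phi>o0 by (intro mult_mono) auto
      also have "\<dots> \<le> D * real r powr \<gamma> * \<Phi>o"
      proof -
        have "1 \<le> 2 * exp (1::real)" using e1(1) by linarith
        then have "1 * C \<le> 2 * exp 1 * C" using C by (intro mult_right_mono) auto
        then have "C * (real r powr \<gamma> * \<Phi>o) \<le> D * (real r powr \<gamma> * \<Phi>o)"
          unfolding D_def using \<Phi>o0 by (intro mult_right_mono) auto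
        then show ?thesis by (simp add: mult_ac)
      qed
      also note F_gt
      \<comment> \<open>The squared-logarithm term lies strictly below \<open>F\<close>, so the
        maximum defining the rate is attained by \<open>Phi_star\<close>.\<close>
      finally have F: "F = (real r)\<^sup>2 * l\<^sup>2 + \<nu>\<^sup>2"
        unfolding F_def by (auto simp: Phi_adp_def \<Phi> L_def r(3) max_def split: if_splits)
      obtain X where X: "X \<ge> 0"
        "X = r * l + \<nu> \<or> X = r * l \<and> L > 1 \<and> (\<exists>j\<in>{1..d}. \<nu>\<^sup>2 \<le> L\<^sup>2 * (\<eta> j)\<^sup>2)"
        "\<And>R0 R1. R0 \<ge> 0 \<Longrightarrow> R1 \<ge> 0 \<Longrightarrow> max_risk d \<eta> \<sigma> \<alpha> \<tau> T r \<le> ennreal R1 \<Longrightarrow>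
          max_risk d \<eta> \<sigma> \<alpha> \<tau> T 1 \<le> ennreal R0 \<Longrightarrow> R1 \<le> (\<sigma> * y * X)\<^sup>2 / 16 \<Longrightarrow>
          (\<sigma> * y * X)\<^sup>2 \<le> 2 * exp 1 * real r powr \<gamma> * R0"
        using tradeoff[OF r(1), folded l_def \<nu>_def L_def] by blast
      \<comment> \<open>When thinning removed an index, \<open>\<nu>\<^sup>2\<close> is at most
        \<open>L\<^sup>2\<close> times a squared coefficient, hence at most \<open>F / 2\<close>;
        the threshold part alone then carries the other half.\<close>
      have F_X: "F / 2 \<le> X\<^sup>2"
        using X(2)
      proof
        assume X: "X = r * l + \<nu>"
        have "\<nu> \<ge> 0"
          using r(1) by (auto simp: \<nu>_def nu_star_def ln_exp_mult intro!: mult_nonneg_nonneg sum_nonneg)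
        then have "0 \<le> r * l * \<nu>" using l0 by simp
        then have "F \<le> X\<^sup>2" unfolding F X by (simp add: power2_eq_square algebra_simps)
        then show ?thesis using zero_le_power2[of X] by linarith
      next
        assume *: "X = r * l \<and> L > 1 \<and> (\<exists>j\<in>{1..d}. \<nu>\<^sup>2 \<le> L\<^sup>2 * (\<eta> j)\<^sup>2)"
        then obtain j where j: "j \<in> {1..d}" "\<nu>\<^sup>2 \<le> L\<^sup>2 * (\<eta> j)\<^sup>2" by auto
        note j(2)
        also have "L\<^sup>2 * (\<eta> j)\<^sup>2 \<le> C * real r powr \<gamma> * (exp 1 * \<Phi>o)"
          using C by (intro mult_mono L2 \<eta>_le j(1)) auto
        also have "\<dots> = D * real r powr \<gamma> * \<Phi>o / 2" by (simp add: D_def)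
        also have "\<dots> \<le> F / 2" using F_gt by simp
        finally have "\<nu>\<^sup>2 \<le> F / 2" .
        moreover have "X\<^sup>2 = (real r)\<^sup>2 * l\<^sup>2" using * by (simp add: power_mult_distrib)
        ultimately show ?thesis using F by linarith
      qed
      have F0: "F \<ge> 0" unfolding F by simp
      have scale: "\<sigma>\<^sup>2 * y\<^sup>2 * (F / 2) \<le> (\<sigma> * y * X)\<^sup>2"
        unfolding power_mult_distrib by (intro mult_left_mono F_X) auto
      have "(\<sigma> * y * X)\<^sup>2 \<le> 2 * exp 1 * real r powr \<gamma> * R"
      proof (rule X(3))
        \<comment> \<open>The constant 32 is the 16 of the trade-off times the factor 2 between
          \<open>F\<close> and \<open>X\<^sup>2\<close>.\<close>
        show "max_risk d \<eta> \<sigma> \<alpha> \<tau> T r \<le> ennreal (\<sigma>\<^sup>2 / (32 / y\<^sup>2) * F)"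
          using max_risk_mono[OF r(2)] hyp unfolding F_def by (rule order_trans)
        show "\<sigma>\<^sup>2 / (32 / y\<^sup>2) * F \<le> (\<sigma> * y * X)\<^sup>2 / 16" using scale by (simp add: mult_ac)
      qed (use real F0 in auto)
      with scale have "\<sigma>\<^sup>2 * y\<^sup>2 * F \<le> 4 * exp 1 * real r powr \<gamma> * R" by simp
      also have "\<dots> \<le> (16 * D) * real r powr \<gamma> * R"
        using e1 D real by (intro mult_right_mono) auto
      finally have "\<sigma>\<^sup>2 * (y\<^sup>2 / (16 * D)) * (F / real r powr \<gamma>) \<le> R"
        using D rg r(1) by (simp add: field_simps)
      \<comment> \<open>As \<open>D \<ge> 1\<close>, the first argument of the maximum dominates in
        this case.\<close>
      moreover have "\<Phi>o \<le> F / real r powr \<gamma>"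
      proof -
        have "1 * (\<Phi>o * real r powr \<gamma>) \<le> D * (\<Phi>o * real r powr \<gamma>)"
          using D \<Phi>o0 by (intro mult_right_mono) auto
        then show ?thesis using F_gt rg r(1) by (simp add: le_divide_eq mult_ac)
      qed
      ultimately show ?thesis by (simp add: max_def)
    qed
    then show ?thesis using real by (simp add: F_def \<Phi>o_def r(3) ennreal_leI)
  qed
  show ?thesis
  proof (rule exI[of _ \<tau>\<^sub>0], rule exI[of _ "32 / y\<^sup>2"], rule exI[of _ "y\<^sup>2 / (16 * D)"],
      intro conjI allI impI ballI)
    show "\<tau>\<^sub>0 > 0" "32 / y\<^sup>2 > 0" "y\<^sup>2 / (16 * D) > 0" using f(1) y D by auto
  qed (rule main; blast)
qed

end
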